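(* Let $d\ge 1$, let $G$ be a compact Lie group with a fixed maximal torus $\mathcal{T}$ with Lie algebra $\mathfrak{t}$, and let $\alpha\in\mathbb{T}^d$ be Diophantine. Then every almost reducible cocycle $\Phi=(\alpha,A(\cdot))$, $A(\cdot)\in C^\infty(\mathbb{T}^d,G)$, admits a fibered rotation vector $\varrho(\Phi)$: there exist $s\in\mathbb{R}$, $H(\cdot)\in H^s(\mathbb{T}^d,G)$ and $a_\infty\in\mathfrak{t}$ such that, with $A_\infty=\exp(a_\infty)\in\mathcal{T}$, the cocycle $\Phi$ is conjugate to $(\alpha,A_\infty)$ via $H(\cdot)$ in the sense of $H^s$ reducibility.
   Context: $\mathbb{T}^d=\mathbb{R}^d/\mathbb{Z}^d$. A vector $\alpha\in\mathbb{T}^d$ is Diophantine if there are $\gamma,\tau>0$ with $|\alpha\cdot k|_{\mathbb{Z}}\ge \gamma^{-1}|k|^{-\tau}$ for all $k\in\mathbb{Z}^d\setminus\{0\}$, where $|\cdot|_{\mathbb{Z}}$ is the distance to the nearest integer. A (smooth quasi-periodic) cocycle over $\alpha$ is a pair $\Phi=(\alpha,A(\cdot))$ with $A(\cdot)\in C^\infty(\mathbb{T}^d,G)$, acting on $\mathbb{T}^d\times G$ by $(x,S)\mapsto(x+\alpha,A(x)S)$. It is constant if $A(\cdot)$ is a constant map. For $H(\cdot)\in C^\infty(\mathbb{T}^d,G)$, $\mathrm{Conj}_{H(\cdot)}(\alpha,A(\cdot))=(\alpha,H(\cdot+\alpha)A(\cdot)H^*(\cdot))$, where $H^*(x)=H(x)^{-1}$.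 Convergence of cocycles over $\alpha$ in $C^\infty$ means convergence of the maps $A(\cdot)$ in $C^\infty$. $\Phi=(\alpha,A(\cdot))$ is almost reducible if there exist $H_i(\cdot)\in C^\infty(\mathbb{T}^d,G)$ and constants $A_i\in G$ with $A_i^*H_i(\cdot+\alpha)A(\cdot)H_i^*(\cdot)\to\mathrm{Id}$ in $C^\infty$. Sobolev spaces: $G$ is regarded as a group of unitary matrices, and $H^s$ ($s\in\mathbb{R}$) convergence of $G$-valued maps on $\mathbb{T}^d$ means convergence of matrix entries in the usual Sobolev space $H^s(\mathbb{T}^d)$. $\Phi$ is $H^s$ reducible to the constant cocycle $(\alpha,A_\infty)$ via $H(\cdot)\in H^s(\mathbb{T}^d,G)$ if there is a sequence $H_i(\cdot)\in C^\infty(\mathbb{T}^d,G)$ such that $\mathrm{Conj}_{H_i(\cdot)}\Phi\to(\alpha,A_\infty)$ in $C^\infty$ and $H_i(\cdot)\to H(\cdot)$ in $H^s$. Rotation vector: if $a_\infty\in\mathfrak{t}$ and $\Phi$ is conjugate to $(\alpha,\exp(a_\infty))$ via some $H(\cdot)\in H^s(\mathbb{T}^d,G)$, $s\in\mathbb{R}$, in this sense, then $a_\infty$ is called a rotation vector for $\Phi$, written $a_\infty=\varrho(\Phi)$.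
   Formalization: The compact Lie group G is assumed connected; otherwise the claim fails, e.g. G=O(2) with A a constant reflection, which cannot be conjugated into the maximal torus SO(2). If A takes values in the identity component, the claim follows by applying the theorem to that component. *)

theory Defs
  imports "HOL-Analysis.Analysis"
begin

section \<open>Compact Lie groups of unitary matrices\<close>

definition adjoint_matrix :: "complex^'n^'n \<Rightarrow> complex^'n^'n" where
  "adjoint_matrix X = (\<chi> i j. cnj (X $ j $ i))"

definition unitary_matrix :: "complex^'n^'n \<Rightarrow> bool" where
  "unitary_matrix X \<longleftrightarrow> X ** adjoint_matrix X = mat 1 \<and> adjoint_matrix X ** X = mat 1"

definition matrix_subgroup :: "(complex^'n^'n) set \<Rightarrow> bool" where
  "matrix_subgroup G \<longleftrightarrow> mat 1 \<in> G \<and>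
     (\<forall>X\<in>G. invertible X \<and> matrix_inv X \<in> G) \<and> (\<forall>X\<in>G. \<forall>Y\<in>G. X ** Y \<in> G)"

text \<open>A compact Lie group is regarded as a group of unitary matrices. By the closed subgroup
  theorem every compact subgroup of the unitary group is an embedded Lie subgroup, and by
  Peter--Weyl every compact Lie group arises in this way.\<close>
definition compact_lie_group :: "(complex^'n^'n) set \<Rightarrow> bool" where
  "compact_lie_group G \<longleftrightarrow> matrix_subgroup G \<and> compact G \<and> (\<forall>X\<in>G. unitary_matrix X)"

definition torus_group :: "(complex^'n^'n) set \<Rightarrow> bool" where
  "torus_group T \<longleftrightarrow> compact_lie_group T \<and> connected T \<and> (\<forall>X\<in>T. \<forall>Y\<in>T. X ** Y = Y ** X)"

definition maximal_torus :: "(complex^'n^'n) set \<Rightarrow> (complex^'n^'n) set \<Rightarrow> bool" where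
  "maximal_torus G T \<longleftrightarrow> torus_group T \<and> T \<subseteq> G \<and>
     (\<forall>T'. torus_group T' \<and> T' \<subseteq> G \<and> T \<subseteq> T' \<longrightarrow> T' = T)"

text \<open>The multiplication \<open>*\<close> on \<open>complex^'n^'n\<close> is entrywise, so the generic \<open>exp\<close> is not the
  matrix exponential.\<close>
definition matrix_exp :: "complex^'n^'n \<Rightarrow> complex^'n^'n" where
  "matrix_exp X = (\<Sum>k. (1 / fact k) *\<^sub>R (((**) X) ^^ k) (mat 1))"

definition lie_algebra :: "(complex^'n^'n) set \<Rightarrow> (complex^'n^'n) set" where
  "lie_algebra G = {X. \<forall>t::real. matrix_exp (t *\<^sub>R X) \<in> G}"

section \<open>The torus \<open>\<real>\<^sup>d / \<int>\<^sup>d\<close> and smooth maps on it\<close>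

text \<open>Points of the torus are given by representatives in \<open>real^'d\<close>, and maps on the torus are
  \<open>\<int>\<^sup>d\<close>-periodic maps on \<open>real^'d\<close>; the dimension is \<open>d = CARD('d) \<ge> 1\<close>.\<close>

definition lattice_vec :: "int^'d \<Rightarrow> real^'d" where
  "lattice_vec k = (\<chi> i. of_int (k $ i))"

definition diophantine :: "real^'d \<Rightarrow> bool" where
  "diophantine \<alpha> \<longleftrightarrow> (\<exists>\<gamma>>0. \<exists>\<tau>>0. \<forall>k. k \<noteq> 0 \<longrightarrow>
     infdist (\<alpha> \<bullet> lattice_vec k) \<int> \<ge> inverse \<gamma> * norm (lattice_vec k) powr (- \<tau>))"

primrec partial_derivs ::
  "'d list \<Rightarrow> (real^'d \<Rightarrow> 'b::real_normed_vector) \<Rightarrow> real^'d \<Rightarrow> 'b" where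
  "partial_derivs [] f = f"
| "partial_derivs (i # is) f =
     (\<lambda>x. frechet_derivative (partial_derivs is f) (at x) (axis i 1))"

definition torus_smooth :: "(real^'d \<Rightarrow> 'b::real_normed_vector) set" where
  "torus_smooth = {f. (\<forall>x k. f (x + lattice_vec k) = f x) \<and>
     (\<forall>is x. partial_derivs is f differentiable (at x))}"

definition torus_smooth_into :: "'b::real_normed_vector set \<Rightarrow> (real^'d \<Rightarrow> 'b) set" where
  "torus_smooth_into G = {f \<in> torus_smooth. \<forall>x. f x \<in> G}"

definition smooth_converges ::
  "(nat \<Rightarrow> real^'d \<Rightarrow> 'b::real_normed_vector) \<Rightarrow> (real^'d \<Rightarrow> 'b) \<Rightarrow> bool" where
  "smooth_converges F f \<longleftrightarrow> (\<forall>m. F m \<in> torus_smooth) \<and> f \<in> torus_smooth \<and>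
     (\<forall>is. uniform_limit UNIV (\<lambda>m. partial_derivs is (F m)) (partial_derivs is f) sequentially)"

section \<open>Distributions and Sobolev spaces on the torus\<close>

type_synonym 'd torus_functional = "(real^'d \<Rightarrow> complex) \<Rightarrow> complex"

text \<open>Only the values on smooth periodic test functions matter. The space of test functions is a
  Frechet space, so that sequential continuity is continuity.\<close>
definition torus_distribution :: "'d::finite torus_functional \<Rightarrow> bool" where
  "torus_distribution u \<longleftrightarrow>
     (\<forall>f\<in>torus_smooth. \<forall>g\<in>torus_smooth. \<forall>c. u (\<lambda>x. c * f x + g x) = c * u f + u g) \<and>
     (\<forall>F f. smooth_converges F f \<longrightarrow> (\<lambda>m. u (F m)) \<longlonglongrightarrow> u f)"

definition distribution_of :: "(real^'d \<Rightarrow> complex) \<Rightarrow> 'd::finite torus_functional" where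
  "distribution_of f = (\<lambda>\<phi>. integral (cbox 0 1) (\<lambda>x. f x * \<phi> x))"

definition fourier_coeff :: "'d::finite torus_functional \<Rightarrow> int^'d \<Rightarrow> complex" where
  "fourier_coeff u k = u (\<lambda>x. cis (- 2 * pi * (x \<bullet> lattice_vec k)))"

definition sobolev_weight :: "real \<Rightarrow> int^'d \<Rightarrow> real" where
  "sobolev_weight s k = (1 + (norm (lattice_vec k))\<^sup>2) powr s"

definition sobolev :: "real \<Rightarrow> 'd::finite torus_functional set" where
  "sobolev s = {u. torus_distribution u \<and>
     (\<lambda>k. sobolev_weight s k * (norm (fourier_coeff u k))\<^sup>2) summable_on UNIV}"

definition sobolev_dist :: "real \<Rightarrow> 'd::finite torus_functional \<Rightarrow> 'd::finite torus_functional \<Rightarrow> real" where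
  "sobolev_dist s u v =
     sqrt (\<Sum>\<^sub>\<infinity>k. sobolev_weight s k * (norm (fourier_coeff u k - fourier_coeff v k))\<^sup>2)"

definition sobolev_converges ::
  "real \<Rightarrow> (nat \<Rightarrow> 'd::finite torus_functional) \<Rightarrow> 'd::finite torus_functional \<Rightarrow> bool" where
  "sobolev_converges s U u \<longleftrightarrow> (\<forall>m. U m \<in> sobolev s) \<and> u \<in> sobolev s \<and>
     (\<lambda>m. sobolev_dist s (U m) u) \<longlonglongrightarrow> 0"

text \<open>An \<open>H\<^sup>s\<close> map with values in matrices is a matrix of distributions.\<close>
definition sobolev_converges_matrix ::
  "real \<Rightarrow> (nat \<Rightarrow> real^'d \<Rightarrow> complex^'n^'n) \<Rightarrow> ('d::finite torus_functional)^'n^'n \<Rightarrow> bool" where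
  "sobolev_converges_matrix s F H \<longleftrightarrow>
     (\<forall>i j. sobolev_converges s (\<lambda>m. distribution_of (\<lambda>x. F m x $ i $ j)) (H $ i $ j))"

text \<open>The elements of \<open>H\<^sup>s\<close> are genuine distributions for \<open>s < 0\<close>, so that the values in \<open>G\<close> are
  encoded as being an \<open>H\<^sup>s\<close> limit of smooth \<open>G\<close>-valued maps. For \<open>s \<ge> 0\<close> and closed \<open>G\<close> such a
  limit is a function with values in \<open>G\<close> almost everywhere.\<close>
definition sobolev_into ::
  "real \<Rightarrow> (complex^'n^'n) set \<Rightarrow> (('d::finite torus_functional)^'n^'n) set" where
  "sobolev_into s G = {H. \<exists>F. (\<forall>m. F m \<in> torus_smooth_into G) \<and> sobolev_converges_matrix s F H}"

section \<open>Cocycles\<close>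

text \<open>A smooth cocycle over \<open>\<alpha>\<close> is given by a map \<open>A \<in> torus_smooth_into G\<close>.\<close>

definition conj_cocycle ::
  "real^'d \<Rightarrow> (real^'d \<Rightarrow> complex^'n^'n) \<Rightarrow> (real^'d \<Rightarrow> complex^'n^'n) \<Rightarrow> real^'d \<Rightarrow> complex^'n^'n"
  where "conj_cocycle \<alpha> H A = (\<lambda>x. H (x + \<alpha>) ** A x ** matrix_inv (H x))"

definition almost_reducible ::
  "(complex^'n^'n) set \<Rightarrow> real^'d \<Rightarrow> (real^'d \<Rightarrow> complex^'n^'n) \<Rightarrow> bool" where
  "almost_reducible G \<alpha> A \<longleftrightarrow>
     (\<exists>(H :: nat \<Rightarrow> real^'d \<Rightarrow> complex^'n^'n) (C :: nat \<Rightarrow> complex^'n^'n).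
        (\<forall>m. H m \<in> torus_smooth_into G) \<and> (\<forall>m. C m \<in> G) \<and>
        smooth_converges (\<lambda>m x. matrix_inv (C m) ** conj_cocycle \<alpha> (H m) A x) (\<lambda>_. mat 1))"

definition sobolev_reducible ::
  "real \<Rightarrow> (complex^'n^'n) set \<Rightarrow> real^'d \<Rightarrow> (real^'d \<Rightarrow> complex^'n^'n) \<Rightarrow>
   ('d::finite torus_functional)^'n^'n \<Rightarrow> complex^'n^'n \<Rightarrow> bool" where
  "sobolev_reducible s G \<alpha> A H C \<longleftrightarrow> H \<in> sobolev_into s G \<and> C \<in> G \<and>
     (\<exists>F. (\<forall>m. F m \<in> torus_smooth_into G) \<and>
        smooth_converges (\<lambda>m. conj_cocycle \<alpha> (F m) A) (\<lambda>_. C) \<and>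
        sobolev_converges_matrix s F H)"

definition rotation_vector ::
  "(complex^'n^'n) set \<Rightarrow> (complex^'n^'n) set \<Rightarrow> real^'d \<Rightarrow> (real^'d \<Rightarrow> complex^'n^'n) \<Rightarrow>
   complex^'n^'n \<Rightarrow> bool" where
  "rotation_vector G T \<alpha> A a \<longleftrightarrow> a \<in> lie_algebra T \<and>
     (\<exists>s. \<exists>H \<in> sobolev_into s G. sobolev_reducible s G \<alpha> A H (matrix_exp a))"

end

(* Maps with values in G are bounded, so any sequence of them, seen as functionals on test
   functions, has a cluster point; for s = -d the Sobolev weights are summable, and a subsequence
   converges in H^s by dominated convergence. After passing to a subsequence the constants A_i
   converge in G, so everything reduces to the maximal torus theorem: every element of G is
   conjugate into the torus, and the exponential map of a torus is onto.

   The Lie algebra is the tangent cone at 1, and differences of elements of G near 1 are detected by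
   inner products with it. Hence a point of G close to a set invariant under right multiplication
   by exponentials lies in its closure, as a nearest point would be critical for the distance; so
   products of exponentials are dense. A chain of minimal energy with a given product is constant (a discrete
   geodesic), which makes every such product a single exponential. Finally, an element of the
   adjoint orbit of X with maximal inner product with H commutes with H; repeating this inside the
   stabiliser of H for a basis of the Lie algebra of the torus moves X into it by maximality. *)
theory Submission
  imports Defs
begin

text \<open>No charts, dimension count or inverse function theorem enter: the Lie algebra is known
  only through one-parameter groups, and compactness takes the place of local coordinates. The
  clopen argument, which rests on connectedness, yields only density. For G this suffices, because
  the conjugating elements converge along a subsequence and T is closed. For T it does not, since
  the limit constant has to be exactly \<open>matrix_exp a\<close>; there exp is a homomorphism, and
  a nearest point argument on a small ball of the Lie algebra shows that its image contains a
  neighbourhood of 1. Energy minimisation plays the part of the Hopf-Rinow theorem: fine subdivision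
  makes the links so short that orthogonality to the Lie algebra decides their equality. The
  induction over stabilisers runs over all compact groups, so that no connectedness has to be
  maintained. The functionals live in an uncountable product, where a cluster point need not be the
  limit of a subsequence; one is recovered because closeness in H^{-d} depends, up to a small tail,
  on finitely many Fourier coefficients.\<close>

section \<open>Endomorphisms as a Banach algebra\<close>

text \<open>The product on \<open>complex^'n^'n\<close> is entrywise, so matrices are sent to
  operators, where composition gives a Banach algebra and the theory of the generic
  \<open>exp\<close> applies. A copy of the operator type is taken because a class instance needs a
  type constructor with a single argument.\<close>

typedef (overloaded) 'a endo = "UNIV :: ('a::real_normed_vector \<Rightarrow>\<^sub>L 'a) set"
  morphisms blinfun_of_endo Endo by simp

setup_lifting type_definition_endo

instantiation endo :: (real_normed_vector) real_normed_vector
begin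

lift_definition zero_endo :: "'a endo" is 0 .
lift_definition plus_endo :: "'a endo \<Rightarrow> 'a endo \<Rightarrow> 'a endo" is "(+)" .
lift_definition minus_endo :: "'a endo \<Rightarrow> 'a endo \<Rightarrow> 'a endo" is "(-)" .
lift_definition uminus_endo :: "'a endo \<Rightarrow> 'a endo" is uminus .
lift_definition scaleR_endo :: "real \<Rightarrow> 'a endo \<Rightarrow> 'a endo" is scaleR .
lift_definition norm_endo :: "'a endo \<Rightarrow> real" is norm .
definition dist_endo :: "'a endo \<Rightarrow> 'a endo \<Rightarrow> real" where "dist_endo a b = norm (a - b)"
definition sgn_endo :: "'a endo \<Rightarrow> 'a endo" where "sgn_endo a = scaleR (inverse (norm a)) a"
definition uniformity_endo :: "('a endo \<times> 'a endo) filter" where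
  "uniformity_endo = (INF e\<in>{0<..}. principal {(x, y). dist x y < e})"
definition open_endo :: "'a endo set \<Rightarrow> bool" where
  "open_endo U = (\<forall>x\<in>U. eventually (\<lambda>(x', y). x' = x \<longrightarrow> y \<in> U) uniformity)"

instance
  apply standard
  unfolding dist_endo_def sgn_endo_def uniformity_endo_def open_endo_def
  by (transfer; simp add: algebra_simps norm_triangle_ineq)+

end

text \<open>The sort \<open>perfect_space\<close> excludes the zero space, whose identity has norm
  0.\<close>

instantiation endo :: ("{real_normed_vector, perfect_space}") real_normed_algebra_1
begin

lift_definition one_endo :: "'a endo" is id_blinfun .
lift_definition times_endo :: "'a endo \<Rightarrow> 'a endo \<Rightarrow> 'a endo" is "(o\<^sub>L)" .

instance
proof
  fix a b c :: "'a endo" and r :: real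
  show "a * b * c = a * (b * c)" by transfer (rule blinfun_eqI; simp add: blinfun.bilinear_simps)
  show "(a + b) * c = a * c + b * c" by transfer (rule blinfun_eqI; simp add: blinfun.bilinear_simps)
  show "a * (b + c) = a * b + a * c" by transfer (rule blinfun_eqI; simp add: blinfun.bilinear_simps)
  show "(r *\<^sub>R a) * b = r *\<^sub>R (a * b)" by transfer (rule blinfun_eqI; simp add: blinfun.bilinear_simps)
  show "a * (r *\<^sub>R b) = r *\<^sub>R (a * b)" by transfer (rule blinfun_eqI; simp add: blinfun.bilinear_simps)
  show "1 * a = a" by transfer (rule blinfun_eqI; simp)
  show "a * 1 = a" by transfer (rule blinfun_eqI; simp)
  show "norm (a * b) \<le> norm a * norm b" by transfer (rule norm_blinfun_compose)
  show n1: "norm (1 :: 'a endo) = 1" by transfer (rule norm_blinfun_id)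
  have "norm (0 :: 'a endo) = 0" by simp
  then show "(0 :: 'a endo) \<noteq> 1" using n1 by (metis zero_neq_one)
qed

end

instance endo :: ("{banach, perfect_space}") banach
proof
  fix X :: "nat \<Rightarrow> 'a endo"
  have d: "dist a b = dist (blinfun_of_endo a) (blinfun_of_endo b)" for a b :: "'a endo"
    unfolding dist_norm by transfer simp
  assume "Cauchy X"
  then have "Cauchy (\<lambda>n. blinfun_of_endo (X n))"
    unfolding Cauchy_def d .
  then obtain l where "(\<lambda>n. blinfun_of_endo (X n)) \<longlonglongrightarrow> l"
    using Cauchy_convergent_iff convergent_def by blast
  then have "X \<longlonglongrightarrow> Endo l"
    unfolding lim_sequentially d by (simp add: Endo_inverse)
  then show "convergent X" by (auto simp: convergent_def)
qed

section \<open>The matrix exponential\<close>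

lemma matrix_mult_scaleR_left: "(c *\<^sub>R A) ** B = c *\<^sub>R (A ** B)"
  for A :: "complex^'n^'m" and B :: "complex^'p^'n"
  by (simp add: vec_eq_iff matrix_matrix_mult_def scaleR_right.sum)

lemma matrix_mult_scaleR_right: "A ** (c *\<^sub>R B) = c *\<^sub>R (A ** B)"
  for A :: "complex^'n^'m" and B :: "complex^'p^'n"
  by (simp add: vec_eq_iff matrix_matrix_mult_def scaleR_right.sum)

lemma bounded_bilinear_matrix_mult:
  "bounded_bilinear ((**) :: complex^'n^'m \<Rightarrow> complex^'p^'n \<Rightarrow> complex^'p^'m)"
proof -
  have "bilinear ((**) :: complex^'n^'m \<Rightarrow> complex^'p^'n \<Rightarrow> complex^'p^'m)"
    unfolding bilinear_def
    by (auto intro!: linearI simp: matrix_mult_scaleR_left matrix_mult_scaleR_right)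
      (simp_all add: vec_eq_iff matrix_matrix_mult_def algebra_simps sum.distrib)
  then show ?thesis by (simp add: bilinear_conv_bounded_bilinear)
qed

interpretation matrix_mult: bounded_bilinear
  "(**) :: complex^'n^'m \<Rightarrow> complex^'p^'n \<Rightarrow> complex^'p^'m"
  by (rule bounded_bilinear_matrix_mult)

section \<open>Matrices as operators on C^n\<close>

definition endo_of_matrix :: "complex^'n^'n \<Rightarrow> (complex^'n) endo" where
  "endo_of_matrix A = Endo (Blinfun ((*v) A))"

text \<open>A bounded left inverse of \<open>endo_of_matrix\<close>, by which limits, sums and
  derivatives come back from operators to matrices.\<close>

definition matrix_of_endo :: "(complex^'n) endo \<Rightarrow> complex^'n^'n" where
  "matrix_of_endo B = (\<chi> i j. blinfun_of_endo B (axis j 1) $ i)"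

lemma linear_matrix_vector_complex: "linear ((*v) A)" for A :: "complex^'n^'m"
  by (rule linearI)
    (simp_all add: vec_eq_iff matrix_vector_mult_def scaleR_right.sum algebra_simps sum.distrib)

lemma endo_of_matrix_apply: "blinfun_of_endo (endo_of_matrix A) x = A *v x"
  unfolding endo_of_matrix_def
  by (simp add: Endo_inverse bounded_linear_Blinfun_apply linear_matrix_vector_complex
      linear_conv_bounded_linear[symmetric])

lemma endo_eqI: "(\<And>x. blinfun_of_endo a x = blinfun_of_endo b x) \<Longrightarrow> a = b"
  by (metis blinfun_eqI blinfun_of_endo_inject)

lemma endo_of_matrix_mult: "endo_of_matrix (A ** B) = endo_of_matrix A * endo_of_matrix B"
  by (rule endo_eqI) (simp add: endo_of_matrix_apply times_endo.rep_eq matrix_vector_mul_assoc)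

lemma endo_of_matrix_one: "endo_of_matrix (mat 1) = 1"
  by (rule endo_eqI) (simp add: endo_of_matrix_apply one_endo.rep_eq)

lemma bounded_linear_endo_of_matrix: "bounded_linear (endo_of_matrix :: complex^'n^'n \<Rightarrow> _)"
proof -
  have "linear (endo_of_matrix :: complex^'n^'n \<Rightarrow> _)"
    by (intro linearI endo_eqI)
      (simp_all add: endo_of_matrix_apply plus_endo.rep_eq scaleR_endo.rep_eq blinfun.add_left
        blinfun.scaleR_left vec_eq_iff matrix_vector_mult_def algebra_simps sum.distrib scaleR_right.sum)
  then show ?thesis by (simp add: linear_conv_bounded_linear)
qed

lemma matrix_of_endo_of_matrix: "matrix_of_endo (endo_of_matrix A) = A"
  by (simp add: matrix_of_endo_def endo_of_matrix_apply vec_eq_iff matrix_vector_mult_def axis_def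
      if_distrib if_distribR sum.delta cong: if_cong)

lemma endo_of_matrix_inject: "endo_of_matrix A = endo_of_matrix B \<longleftrightarrow> A = B"
  by (metis matrix_of_endo_of_matrix)

lemma norm_axis_complex: "norm (axis j 1 :: complex^'n) = 1"
proof -
  have "(norm (axis j 1 $ i :: complex))\<^sup>2 = (if i = j then 1 else 0)" for i :: 'n
    by (simp add: axis_def)
  then show ?thesis by (simp add: norm_vec_def L2_set_def)
qed

lemma bounded_linear_matrix_of_endo: "bounded_linear (matrix_of_endo :: _ \<Rightarrow> complex^'n^'n)"
proof (rule bounded_linear_intro[where K = "real CARD('n) * real CARD('n)"])
  fix x y :: "(complex^'n) endo" and r :: real
  show "matrix_of_endo (x + y) = matrix_of_endo x + matrix_of_endo y"
    by (simp add: matrix_of_endo_def vec_eq_iff plus_endo.rep_eq blinfun.add_left)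
  show "matrix_of_endo (r *\<^sub>R x) = r *\<^sub>R matrix_of_endo x"
    by (simp add: matrix_of_endo_def vec_eq_iff scaleR_endo.rep_eq blinfun.scaleR_left)
  have b: "norm (matrix_of_endo x $ i $ j) \<le> norm x" for i j
  proof -
    have "norm (matrix_of_endo x $ i $ j) \<le> norm (blinfun_of_endo x (axis j 1))"
      by (simp add: matrix_of_endo_def Finite_Cartesian_Product.norm_nth_le)
    also have "\<dots> \<le> norm (blinfun_of_endo x) * norm (axis j 1 :: complex^'n)"
      by (rule norm_blinfun)
    also have "\<dots> = norm x" by (simp add: norm_endo.rep_eq norm_axis_complex)
    finally show ?thesis .
  qed
  have "norm (matrix_of_endo x) \<le> (\<Sum>i\<in>UNIV. \<Sum>j\<in>UNIV. norm (matrix_of_endo x $ i $ j))"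
    unfolding norm_vec_def[of "matrix_of_endo x"]
    by (rule order_trans[OF L2_set_le_sum])
      (auto intro!: sum_mono order_trans[OF L2_set_le_sum] simp: norm_vec_def[of "matrix_of_endo x $ _"])
  also have "\<dots> \<le> (\<Sum>i\<in>(UNIV::'n set). \<Sum>j\<in>(UNIV::'n set). norm x)"
    by (intro sum_mono b)
  finally show "norm (matrix_of_endo x) \<le> norm x * (real CARD('n) * real CARD('n))"
    by (simp add: mult_ac)
qed

text \<open>Both sides are the same power series. Summability on the matrix side is the operator
  series pushed through the bounded map \<open>matrix_of_endo\<close>.\<close>

lemma endo_of_matrix_exp: "endo_of_matrix (matrix_exp X) = exp (endo_of_matrix X)"
proof -
  have p: "endo_of_matrix ((((**) X) ^^ k) (mat 1)) = endo_of_matrix X ^ k" for k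
    by (induction k) (simp_all add: endo_of_matrix_one endo_of_matrix_mult)
  have t: "endo_of_matrix ((1 / fact k) *\<^sub>R (((**) X) ^^ k) (mat 1)) = endo_of_matrix X ^ k /\<^sub>R fact k"
    for k
    using p by (simp add: linear_scale[OF bounded_linear.linear[OF bounded_linear_endo_of_matrix]]
        inverse_eq_divide)
  have "summable (\<lambda>k. matrix_of_endo (endo_of_matrix X ^ k /\<^sub>R fact k))"
    by (rule bounded_linear.summable[OF bounded_linear_matrix_of_endo summable_exp_generic])
  then have s: "summable (\<lambda>k. (1 / fact k) *\<^sub>R (((**) X) ^^ k) (mat 1))"
    unfolding t[symmetric] matrix_of_endo_of_matrix .
  show ?thesis
    unfolding matrix_exp_def exp_def
    using bounded_linear.suminf[OF bounded_linear_endo_of_matrix s] by (simp only: t)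
qed

lemma linear_endo_of_matrix: "linear endo_of_matrix"
  using bounded_linear_endo_of_matrix by (rule bounded_linear.linear)

lemma matrix_exp_0 [simp]: "matrix_exp 0 = mat 1"
  by (simp add: endo_of_matrix_inject[symmetric] endo_of_matrix_exp endo_of_matrix_one
      linear_0[OF linear_endo_of_matrix])

lemma matrix_exp_add:
  assumes "X ** Y = Y ** X"
  shows "matrix_exp (X + Y) = matrix_exp X ** matrix_exp Y"
proof -
  have "endo_of_matrix X * endo_of_matrix Y = endo_of_matrix Y * endo_of_matrix X"
    using assms by (simp only: endo_of_matrix_mult[symmetric])
  from exp_add_commuting[OF this] show ?thesis
    by (simp only: endo_of_matrix_inject[symmetric] endo_of_matrix_exp endo_of_matrix_mult
      linear_add[OF linear_endo_of_matrix])
qed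

text \<open>\<open>w\<close> passes through each power of the series, without being invertible. The
  case \<open>v = x\<close> gives commutation with exponentials, and \<open>v\<close> a conjugate of
  \<open>x\<close> gives conjugation of exponentials.\<close>

lemma exp_intertwine:
  fixes w x v :: "'a::{real_normed_algebra_1,banach}"
  assumes "w * x = v * w"
  shows "w * exp x = exp v * w"
proof -
  have p: "w * x ^ k = v ^ k * w" for k
    by (induction k) (simp_all, metis assms mult.assoc)
  have "w * exp x = (\<Sum>k. w * (x ^ k /\<^sub>R fact k))"
    unfolding exp_def by (rule suminf_mult[symmetric, OF summable_exp_generic])
  also have "\<dots> = (\<Sum>k. (v ^ k /\<^sub>R fact k) * w)"
    by (simp add: p)
  also have "\<dots> = exp v * w"
    unfolding exp_def by (rule suminf_mult2[symmetric, OF summable_exp_generic])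
  finally show ?thesis .
qed

lemma matrix_exp_intertwine:
  fixes W X V :: "complex^'n^'n"
  assumes "W ** X = V ** W"
  shows "W ** matrix_exp X = matrix_exp V ** W"
proof -
  have "endo_of_matrix W * endo_of_matrix X = endo_of_matrix V * endo_of_matrix W"
    using assms by (simp only: endo_of_matrix_mult[symmetric])
  from exp_intertwine[OF this] show ?thesis
    by (simp only: endo_of_matrix_exp[symmetric] endo_of_matrix_mult[symmetric] endo_of_matrix_inject)
qed

lemma matrix_exp_has_vector_derivative:
  fixes X :: "complex^'n^'n"
  shows "((\<lambda>t. matrix_exp (t *\<^sub>R X)) has_vector_derivative matrix_exp (t *\<^sub>R X) ** X) (at t within S)"
proof -
  have sc: "endo_of_matrix (r *\<^sub>R X) = r *\<^sub>R endo_of_matrix X" for r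
    using bounded_linear.linear[OF bounded_linear_endo_of_matrix] by (rule linear_scale)
  have m: "matrix_of_endo (exp (r *\<^sub>R endo_of_matrix X)) = matrix_exp (r *\<^sub>R X)" for r
    by (simp only: sc[symmetric] endo_of_matrix_exp[symmetric] matrix_of_endo_of_matrix)
  have d: "matrix_of_endo (exp (r *\<^sub>R endo_of_matrix X) * endo_of_matrix X) = matrix_exp (r *\<^sub>R X) ** X" for r
    by (simp only: sc[symmetric] endo_of_matrix_exp[symmetric] endo_of_matrix_mult[symmetric]
        matrix_of_endo_of_matrix)
  show ?thesis
    using bounded_linear.has_vector_derivative[OF bounded_linear_matrix_of_endo
        exp_scaleR_has_vector_derivative_right[of "endo_of_matrix X" t S]]
    by (simp only: m d)
qed

section \<open>Adjoints and unitary matrices\<close>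

lemma adjoint_mult: "adjoint_matrix (X ** Y) = adjoint_matrix Y ** adjoint_matrix X"
  by (simp add: adjoint_matrix_def matrix_matrix_mult_def vec_eq_iff mult.commute)

lemma adjoint_adjoint [simp]: "adjoint_matrix (adjoint_matrix X) = X"
  by (simp add: adjoint_matrix_def vec_eq_iff)

lemma adjoint_one [simp]: "adjoint_matrix (mat 1) = mat 1"
  by (simp add: adjoint_matrix_def mat_def vec_eq_iff)

lemma bounded_linear_adjoint: "bounded_linear (adjoint_matrix :: complex^'n^'n \<Rightarrow> _)"
proof -
  have "linear (adjoint_matrix :: complex^'n^'n \<Rightarrow> _)"
    by (rule linearI) (simp_all add: adjoint_matrix_def vec_eq_iff)
  then show ?thesis by (simp add: linear_conv_bounded_linear)
qed

lemmas adjoint_diff = linear_diff[OF bounded_linear.linear[OF bounded_linear_adjoint]]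
  and adjoint_scaleR = linear_scale[OF bounded_linear.linear[OF bounded_linear_adjoint]]
  and tendsto_adjoint = bounded_linear.tendsto[OF bounded_linear_adjoint]

text \<open>This is the real Hilbert-Schmidt product. A factor crosses it at the price of an
  adjoint, which is the source of all invariance under unitary multiplication.\<close>

lemma inner_matrix_eq_Re_trace:
  "inner X Y = Re (\<Sum>i\<in>UNIV. (adjoint_matrix X ** Y) $ i $ i)" for X Y :: "complex^'n^'n"
proof -
  have "inner X Y = (\<Sum>j\<in>UNIV. \<Sum>i\<in>UNIV. Re (cnj (X $ j $ i) * Y $ j $ i))"
    by (simp add: inner_vec_def inner_complex_def)
  then show ?thesis
    by (subst (asm) sum.swap) (simp add: adjoint_matrix_def matrix_matrix_mult_def)
qed

lemma inner_mult_left: "inner (A ** X) Y = inner X (adjoint_matrix A ** Y)"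
  for A X Y :: "complex^'n^'n"
  by (simp add: inner_matrix_eq_Re_trace adjoint_mult matrix_mul_assoc)

lemma inner_adjoint: "inner (adjoint_matrix X) (adjoint_matrix Y) = inner X Y"
  for X Y :: "complex^'n^'n"
  by (simp add: inner_vec_def adjoint_matrix_def inner_complex_def) (rule sum.swap)

lemma inner_mult_right: "inner (X ** A) Y = inner X (Y ** adjoint_matrix A)"
  for A X Y :: "complex^'n^'n"
proof -
  have "inner (X ** A) Y = inner (adjoint_matrix A ** adjoint_matrix X) (adjoint_matrix Y)"
    by (simp only: inner_adjoint adjoint_mult[symmetric])
  also have "\<dots> = inner (adjoint_matrix X) (adjoint_matrix (Y ** adjoint_matrix A))"
    by (simp only: inner_mult_left adjoint_mult adjoint_adjoint)
  finally show ?thesis by (simp only: inner_adjoint)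
qed

lemma unitary_mult: "unitary_matrix X \<Longrightarrow> unitary_matrix Y \<Longrightarrow> unitary_matrix (X ** Y)"
  unfolding unitary_matrix_def adjoint_mult by (metis matrix_mul_assoc matrix_mul_rid)

lemma unitary_one: "unitary_matrix (mat 1)"
  by (simp add: unitary_matrix_def)

lemma inner_unitary_left: "unitary_matrix U \<Longrightarrow> inner (U ** X) (U ** Y) = inner X Y"
  for U X Y :: "complex^'n^'n"
  by (simp add: inner_mult_left matrix_mul_assoc unitary_matrix_def)

lemma inner_unitary_right: "unitary_matrix U \<Longrightarrow> inner (X ** U) (Y ** U) = inner X Y"
  for U X Y :: "complex^'n^'n"
  by (simp add: inner_mult_right matrix_mul_assoc[symmetric] unitary_matrix_def)

lemma norm_unitary_left: "unitary_matrix U \<Longrightarrow> norm (U ** X) = norm X"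
  for U X :: "complex^'n^'n"
  by (simp add: norm_eq_sqrt_inner inner_unitary_left)

lemma norm_unitary_right: "unitary_matrix U \<Longrightarrow> norm (X ** U) = norm X"
  for U X :: "complex^'n^'n"
  by (simp add: norm_eq_sqrt_inner inner_unitary_right)

lemma norm_unitary: "unitary_matrix U \<Longrightarrow> norm U = norm (mat 1 :: complex^'n^'n)"
  for U :: "complex^'n^'n"
  using norm_unitary_left[of U "mat 1"] by simp

lemma matrix_inv_unitary: "unitary_matrix U \<Longrightarrow> matrix_inv U = adjoint_matrix U"
proof -
  assume u: "unitary_matrix U"
  then have uu: "U ** adjoint_matrix U = mat 1 \<and> adjoint_matrix U ** U = mat 1"
    by (simp add: unitary_matrix_def)
  from someI[of "\<lambda>A. U ** A = mat 1 \<and> A ** U = mat 1", OF uu]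
  have "U ** matrix_inv U = mat 1"
    unfolding matrix_inv_def by blast
  then have "(adjoint_matrix U ** U) ** matrix_inv U = adjoint_matrix U"
    by (simp only: matrix_mul_assoc[symmetric] matrix_mul_rid)
  then show ?thesis
    using uu by simp
qed

section \<open>Powers of unitary matrices\<close>

abbreviation matrix_power :: "complex^'n^'n \<Rightarrow> nat \<Rightarrow> complex^'n^'n" where
  "matrix_power g m \<equiv> (((**) g) ^^ m) (mat 1)"

lemma unitary_power: "unitary_matrix g \<Longrightarrow> unitary_matrix (matrix_power g m)"
  by (induction m) (auto simp: unitary_one unitary_mult)

text \<open>Telescoping: multiplication by unitary matrices is isometric, so the errors only add
  up.\<close>

lemma norm_unitary_power_diff:
  assumes "unitary_matrix g" "unitary_matrix h"
  shows "norm (matrix_power g m - matrix_power h m) \<le> real m * norm (g - h)"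
proof (induction m)
  case (Suc m)
  have "matrix_power g (Suc m) - matrix_power h (Suc m)
      = g ** (matrix_power g m - matrix_power h m) + (g - h) ** matrix_power h m"
    by (simp add: matrix_mult.diff_left matrix_mult.diff_right)
  also have "norm \<dots> \<le> norm (matrix_power g m - matrix_power h m) + norm (g - h)"
    by (rule order_trans[OF norm_triangle_ineq])
      (simp add: assms norm_unitary_left norm_unitary_right unitary_power)
  finally show ?case using Suc by (simp add: algebra_simps)
qed simp

section \<open>One-parameter groups\<close>

lemma matrix_exp_scaleR_add:
  "matrix_exp ((s + t) *\<^sub>R X) = matrix_exp (s *\<^sub>R X) ** matrix_exp (t *\<^sub>R X)"
  by (simp add: scaleR_add_left matrix_exp_add matrix_mult.scaleR_left matrix_mult.scaleR_right)

lemma matrix_exp_commute: "X ** matrix_exp (t *\<^sub>R X) = matrix_exp (t *\<^sub>R X) ** X"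
  by (rule matrix_exp_intertwine) (simp add: matrix_mult.scaleR_left matrix_mult.scaleR_right)

lemma continuous_matrix_exp_scaleR: "continuous_on S (\<lambda>t. matrix_exp (t *\<^sub>R X))"
  unfolding continuous_on_eq_continuous_within
  by (blast intro: has_vector_derivative_continuous matrix_exp_has_vector_derivative)

lemma matrix_exp_power: "matrix_power (matrix_exp X) m = matrix_exp (real m *\<^sub>R X)"
proof (induction m)
  case (Suc m)
  have "matrix_exp (real (Suc m) *\<^sub>R X) = matrix_exp (1 *\<^sub>R X) ** matrix_exp (real m *\<^sub>R X)"
    by (simp only: matrix_exp_scaleR_add[symmetric]) (simp add: add.commute)
  then show ?case using Suc by simp
qed simp

text \<open>The product of the adjoint of \<open>matrix_exp (t *\<^sub>R X)\<close> with this matrix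
  is constant in \<open>t\<close>: the two terms of its derivative cancel by skewness.\<close>

lemma unitary_matrix_exp:
  assumes skew: "adjoint_matrix X = - X"
  shows "unitary_matrix (matrix_exp X)"
proof -
  let ?E = "\<lambda>t::real. matrix_exp (t *\<^sub>R X)"
  have "((\<lambda>t. adjoint_matrix (?E t) ** ?E t) has_vector_derivative 0) (at t within UNIV)" for t
  proof -
    have "((\<lambda>t. adjoint_matrix (?E t) ** ?E t) has_vector_derivative
        adjoint_matrix (?E t) ** (?E t ** X) + adjoint_matrix (?E t ** X) ** ?E t) (at t)"
      by (intro matrix_mult.has_vector_derivative bounded_linear.has_vector_derivative[OF bounded_linear_adjoint]
          matrix_exp_has_vector_derivative)
    moreover have "adjoint_matrix (?E t) ** (?E t ** X) + adjoint_matrix (?E t ** X) ** ?E t = 0"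
      by (simp add: matrix_exp_commute[symmetric] adjoint_mult skew matrix_mult.minus_right
          matrix_mult.minus_left matrix_mul_assoc)
    ultimately show ?thesis by simp
  qed
  then obtain c where c: "\<And>t. adjoint_matrix (?E t) ** ?E t = c"
    using has_vector_derivative_zero_constant[of UNIV "\<lambda>t. adjoint_matrix (?E t) ** ?E t"] by auto
  have "adjoint_matrix (?E 1) ** ?E 1 = mat 1"
    using c[of 0] c[of 1] by simp
  then show ?thesis
    using matrix_left_right_inverse by (auto simp: unitary_matrix_def)
qed

text \<open>The derivative at 0 in sequential form: the generator of a one-parameter group is a
  tangent vector. \<open>lie_of_tangent\<close> is the converse.\<close>

lemma matrix_exp_difference_quotient:
  assumes c: "filterlim c at_top sequentially"
  shows "(\<lambda>m. c m *\<^sub>R (matrix_exp (inverse (c m) *\<^sub>R X) - mat 1)) \<longlonglongrightarrow> X"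
proof -
  have z: "(\<lambda>m. inverse (c m)) \<longlonglongrightarrow> 0"
    using c by (rule tendsto_inverse_0_at_top)
  have "((\<lambda>t. matrix_exp (t *\<^sub>R X)) has_vector_derivative X) (at 0)"
    using matrix_exp_has_vector_derivative[of X 0 UNIV] by simp
  then have "((\<lambda>t. (matrix_exp (t *\<^sub>R X) - mat 1 - t *\<^sub>R X) /\<^sub>R \<bar>t\<bar>) \<longlongrightarrow> 0) (at 0)"
    by (simp add: has_vector_derivative_def has_derivative_at_within)
  moreover have "filterlim (\<lambda>m. inverse (c m)) (at 0) sequentially"
    unfolding filterlim_at
    using z eventually_compose_filterlim[OF eventually_gt_at_top[of 0] c]
    by (auto elim!: eventually_mono)
  ultimately have "(\<lambda>m. (matrix_exp (inverse (c m) *\<^sub>R X) - mat 1 - inverse (c m) *\<^sub>R X)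
      /\<^sub>R \<bar>inverse (c m)\<bar>) \<longlonglongrightarrow> 0"
    by (rule filterlim_compose)
  moreover have "\<forall>\<^sub>F m in sequentially.
      (matrix_exp (inverse (c m) *\<^sub>R X) - mat 1 - inverse (c m) *\<^sub>R X) /\<^sub>R \<bar>inverse (c m)\<bar>
      = c m *\<^sub>R (matrix_exp (inverse (c m) *\<^sub>R X) - mat 1) - X"
    using eventually_compose_filterlim[OF eventually_gt_at_top[of 0] c]
    by (auto elim!: eventually_mono simp: scaleR_diff_right)
  ultimately show ?thesis
    by (auto dest: Lim_transform_eventually simp: LIM_zero_iff)
qed

lemma tendsto_one_of_scaled:
  fixes g :: "nat \<Rightarrow> complex^'n^'n"
  assumes c: "filterlim c at_top sequentially" and X: "(\<lambda>m. c m *\<^sub>R (g m - mat 1)) \<longlonglongrightarrow> X"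
  shows "g \<longlonglongrightarrow> mat 1"
proof -
  have "(\<lambda>m. inverse (c m) *\<^sub>R (c m *\<^sub>R (g m - mat 1))) \<longlonglongrightarrow> 0 *\<^sub>R X"
    by (intro tendsto_scaleR tendsto_inverse_0_at_top c X)
  moreover have "\<forall>\<^sub>F m in sequentially. inverse (c m) *\<^sub>R (c m *\<^sub>R (g m - mat 1)) = g m - mat 1"
    using eventually_compose_filterlim[OF eventually_gt_at_top[of 0] c]
    by (auto elim!: eventually_mono)
  ultimately have "(\<lambda>m. g m - mat 1) \<longlonglongrightarrow> 0"
    by (auto dest: Lim_transform_eventually)
  then show ?thesis by (simp add: LIM_zero_iff)
qed

text \<open>For unitary \<open>g\<close>, the product of the adjoint of \<open>g\<close> with
  \<open>g - mat 1\<close> is exactly minus the adjoint of \<open>g - mat 1\<close>. Scaling by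
  \<open>c m\<close> and passing to the limit gives skewness.\<close>

lemma tangent_skew:
  assumes u: "\<And>m. unitary_matrix (g m)"
    and c: "filterlim c at_top sequentially" and X: "(\<lambda>m. c m *\<^sub>R (g m - mat 1)) \<longlonglongrightarrow> X"
  shows "adjoint_matrix X = - X"
proof (rule LIMSEQ_unique)
  show "(\<lambda>m. adjoint_matrix (c m *\<^sub>R (g m - mat 1))) \<longlonglongrightarrow> adjoint_matrix X"
    by (intro tendsto_adjoint X)
  have "(\<lambda>m. - (adjoint_matrix (g m) ** (c m *\<^sub>R (g m - mat 1)))) \<longlonglongrightarrow> - (adjoint_matrix (mat 1) ** X)"
    by (intro tendsto_intros matrix_mult.tendsto tendsto_adjoint X tendsto_one_of_scaled[OF c X])
  moreover have "- (adjoint_matrix (g m) ** (c m *\<^sub>R (g m - mat 1)))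
      = adjoint_matrix (c m *\<^sub>R (g m - mat 1))" for m
    using u[of m]
    by (simp add: unitary_matrix_def matrix_mult.scaleR_right matrix_mult.diff_right
        adjoint_scaleR adjoint_diff scaleR_diff_right)
  ultimately show "(\<lambda>m. adjoint_matrix (c m *\<^sub>R (g m - mat 1))) \<longlonglongrightarrow> - X"
    by simp
qed

text \<open>The unitary matrix \<open>g m\<close> is compared with the exponential of \<open>X / c m\<close>, which is also unitary,
  so that the telescoping estimate applies to their powers.\<close>
lemma unitary_power_tendsto_exp:
  assumes u: "\<And>m. unitary_matrix (g m)"
    and c: "filterlim c at_top sequentially" and X: "(\<lambda>m. c m *\<^sub>R (g m - mat 1)) \<longlonglongrightarrow> X"
    and k: "(\<lambda>m. real (k m) / c m) \<longlonglongrightarrow> t"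
  shows "(\<lambda>m. matrix_power (g m) (k m)) \<longlonglongrightarrow> matrix_exp (t *\<^sub>R X)"
proof -
  define h where "h m = matrix_exp (inverse (c m) *\<^sub>R X)" for m
  have uh: "unitary_matrix (h m)" for m
    unfolding h_def using tangent_skew[OF u c X] by (intro unitary_matrix_exp) (simp add: adjoint_scaleR)
  have hk: "matrix_power (h m) (k m) = matrix_exp ((real (k m) / c m) *\<^sub>R X)" for m
    unfolding h_def by (simp add: matrix_exp_power divide_inverse)
  have "(\<lambda>m. matrix_power (h m) (k m)) \<longlonglongrightarrow> matrix_exp (t *\<^sub>R X)"
    unfolding hk using continuous_matrix_exp_scaleR[of UNIV X] k
    by (auto simp: continuous_on_eq_continuous_within intro: isCont_tendsto_compose)
  moreover have "(\<lambda>m. matrix_power (g m) (k m) - matrix_power (h m) (k m)) \<longlonglongrightarrow> 0"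
  proof (rule Lim_null_comparison)
    \<comment> \<open>The factor \<open>k m\<close> from telescoping is written as the bounded ratio
      \<open>k m / c m\<close> times \<open>c m\<close>; the latter rescales the two differences to
      the identity, which have the same limit \<open>X\<close>.\<close>
    show "\<forall>\<^sub>F m in sequentially. norm (matrix_power (g m) (k m) - matrix_power (h m) (k m))
      \<le> (real (k m) / c m) * norm (c m *\<^sub>R (g m - mat 1) - c m *\<^sub>R (h m - mat 1))"
      using eventually_compose_filterlim[OF eventually_gt_at_top[of 0] c]
    proof eventually_elim
      case (elim m)
      have "c m *\<^sub>R (g m - mat 1) - c m *\<^sub>R (h m - mat 1) = c m *\<^sub>R (g m - h m)"
        by (simp add: scaleR_diff_right)
      then show ?case
        using norm_unitary_power_diff[OF u[of m] uh[of m], of "k m"] elim by simp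
    qed
    have "(\<lambda>m. (real (k m) / c m) * norm (c m *\<^sub>R (g m - mat 1) - c m *\<^sub>R (h m - mat 1)))
      \<longlonglongrightarrow> t * norm (X - X)"
      unfolding h_def by (intro tendsto_intros k X matrix_exp_difference_quotient c)
    then show "(\<lambda>m. (real (k m) / c m) * norm (c m *\<^sub>R (g m - mat 1) - c m *\<^sub>R (h m - mat 1))) \<longlonglongrightarrow> 0"
      by simp
  qed
  ultimately show ?thesis
    using tendsto_add by fastforce
qed

section \<open>The Lie algebra of a compact group\<close>

locale compact_unitary_group =
  fixes G :: "(complex^'n^'n) set"
  assumes compact_lie_group: "compact_lie_group G"
begin

lemma compact_G: "compact G" and unitary: "g \<in> G \<Longrightarrow> unitary_matrix g"
  and one_in: "mat 1 \<in> G" and mult_in: "g \<in> G \<Longrightarrow> h \<in> G \<Longrightarrow> g ** h \<in> G"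
  using compact_lie_group by (auto simp: compact_lie_group_def matrix_subgroup_def)

lemma closed_G: "closed G"
  using compact_G by (rule compact_imp_closed)

lemma adjoint_in: "g \<in> G \<Longrightarrow> adjoint_matrix g \<in> G"
  using compact_lie_group matrix_inv_unitary[OF unitary]
  by (auto simp: compact_lie_group_def matrix_subgroup_def)

lemma adjoint_mult_self: "g \<in> G \<Longrightarrow> adjoint_matrix g ** g = mat 1"
  and mult_adjoint_self: "g \<in> G \<Longrightarrow> g ** adjoint_matrix g = mat 1"
  using unitary by (auto simp: unitary_matrix_def)

lemma power_in: "g \<in> G \<Longrightarrow> matrix_power g m \<in> G"
  by (induction m) (auto simp: one_in mult_in)

lemma matrix_exp_minus_adjoint:
  "unitary_matrix (matrix_exp X) \<Longrightarrow> matrix_exp (- X) = adjoint_matrix (matrix_exp X)"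
proof -
  assume u: "unitary_matrix (matrix_exp X)"
  have "matrix_exp (- X) ** matrix_exp X = mat 1"
    using matrix_exp_add[of "- X" X] by (simp add: matrix_mult.minus_left matrix_mult.minus_right)
  then have "matrix_exp (- X) ** (matrix_exp X ** adjoint_matrix (matrix_exp X))
      = adjoint_matrix (matrix_exp X)"
    by (simp only: matrix_mul_assoc matrix_mul_lid)
  then show ?thesis using u by (simp add: unitary_matrix_def)
qed

text \<open>About \<open>t * c m\<close> steps of size \<open>1 / c m\<close> cover the time
  \<open>t\<close>: these powers of \<open>g m\<close> stay in the closed set \<open>G\<close> and
  tend to \<open>matrix_exp (t *\<^sub>R X)\<close>. Negative times follow by taking
  inverses.\<close>

lemma lie_of_tangent:
  assumes g: "\<And>m. g m \<in> G"
    and c: "filterlim c at_top sequentially" and X: "(\<lambda>m. c m *\<^sub>R (g m - mat 1)) \<longlonglongrightarrow> X"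
  shows "X \<in> lie_algebra G"
proof -
  have pos: "matrix_exp (t *\<^sub>R X) \<in> G" if "t \<ge> 0" for t
  proof -
    let ?k = "\<lambda>m. nat \<lfloor>t * c m\<rfloor>"
    have ev: "\<forall>\<^sub>F m in sequentially. 0 < c m"
      using eventually_compose_filterlim[OF eventually_gt_at_top[of 0] c] .
    have i0: "(\<lambda>m. inverse (c m)) \<longlonglongrightarrow> 0"
      using c by (rule tendsto_inverse_0_at_top)
    have "(\<lambda>m. real (?k m) / c m) \<longlonglongrightarrow> t"
    proof (rule tendsto_sandwich)
      show "\<forall>\<^sub>F m in sequentially. t - inverse (c m) \<le> real (?k m) / c m"
        using ev
      proof eventually_elim
        case (elim m)
        have "t - inverse (c m) = (t * c m - 1) / c m"
          using elim by (simp add: field_simps)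
        also have "\<dots> \<le> real (?k m) / c m"
          using elim by (intro divide_right_mono) linarith+
        finally show ?case .
      qed
      show "\<forall>\<^sub>F m in sequentially. real (?k m) / c m \<le> t"
        using ev by eventually_elim (simp add: field_simps that)
      show "(\<lambda>m. t - inverse (c m)) \<longlonglongrightarrow> t"
        using tendsto_diff[OF tendsto_const i0, of t] by simp
    qed simp
    then have "(\<lambda>m. matrix_power (g m) (?k m)) \<longlonglongrightarrow> matrix_exp (t *\<^sub>R X)"
      by (rule unitary_power_tendsto_exp[OF unitary[OF g] c X])
    then show ?thesis
      by (rule closed_sequentially[OF closed_G power_in[OF g]])
  qed
  have neg: "matrix_exp (t *\<^sub>R X) \<in> G" if "t < 0" for t
    using pos[of "- t"] that matrix_exp_minus_adjoint[of "(- t) *\<^sub>R X"] unitary adjoint_in by auto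
  show ?thesis
    unfolding lie_algebra_def
  proof (intro CollectI allI)
    fix t :: real
    show "matrix_exp (t *\<^sub>R X) \<in> G"
      by (cases "t < 0") (auto intro: pos neg)
  qed
qed

lemma exp_in: "X \<in> lie_algebra G \<Longrightarrow> matrix_exp X \<in> G"
  unfolding lie_algebra_def by (drule CollectD, drule spec[of _ 1]) simp

lemma exp_scaleR_in: "X \<in> lie_algebra G \<Longrightarrow> matrix_exp (t *\<^sub>R X) \<in> G"
  by (simp add: lie_algebra_def)

lemma lie_scaleR: "X \<in> lie_algebra G \<Longrightarrow> t *\<^sub>R X \<in> lie_algebra G"
  by (simp add: lie_algebra_def)

lemma filterlim_real_Suc: "filterlim (\<lambda>m. real (Suc m)) at_top sequentially"
  using filterlim_compose[OF filterlim_real_sequentially filterlim_Suc] .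

lemma lie_zero: "0 \<in> lie_algebra G"
  by (simp add: lie_algebra_def one_in)

text \<open>The exponential is not additive, so membership is read off from tangency: the product of
  the two one-parameter groups has tangent \<open>X + Y\<close> at the identity.\<close>

lemma lie_add:
  assumes X: "X \<in> lie_algebra G" and Y: "Y \<in> lie_algebra G"
  shows "X + Y \<in> lie_algebra G"
proof (rule lie_of_tangent[OF _ filterlim_real_Suc])
  let ?c = "\<lambda>m. real (Suc m)"
  let ?e = "\<lambda>X m. matrix_exp (inverse (real (Suc m)) *\<^sub>R X)"
  show "?e X m ** ?e Y m \<in> G" for m
    by (intro mult_in exp_scaleR_in X Y)
  have 1: "(\<lambda>m. ?c m *\<^sub>R (?e Z m - mat 1)) \<longlonglongrightarrow> Z" for Z :: "complex^'n^'n"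
    by (rule matrix_exp_difference_quotient[OF filterlim_real_Suc])
  have "(\<lambda>m. (?c m *\<^sub>R (?e X m - mat 1)) ** ?e Y m + ?c m *\<^sub>R (?e Y m - mat 1)) \<longlonglongrightarrow> X ** mat 1 + Y"
    by (intro tendsto_add matrix_mult.tendsto 1 tendsto_one_of_scaled[OF filterlim_real_Suc 1])
  moreover have "(?c m *\<^sub>R (?e X m - mat 1)) ** ?e Y m + ?c m *\<^sub>R (?e Y m - mat 1)
      = ?c m *\<^sub>R (?e X m ** ?e Y m - mat 1)" for m
    by (simp only: matrix_mult.scaleR_left scaleR_add_right[symmetric])
      (simp add: matrix_mult.diff_left)
  ultimately show "(\<lambda>m. ?c m *\<^sub>R (?e X m ** ?e Y m - mat 1)) \<longlonglongrightarrow> X + Y"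
    by simp
qed

lemma subspace_lie: "subspace (lie_algebra G)"
  by (simp add: subspace_def lie_zero lie_add lie_scaleR)

lemma closed_lie: "closed (lie_algebra G)"
  using subspace_lie by (rule closed_subspace)

lemma lie_skew:
  assumes "X \<in> lie_algebra G"
  shows "adjoint_matrix X = - X"
  by (rule tangent_skew[OF _ filterlim_real_Suc matrix_exp_difference_quotient[OF filterlim_real_Suc]])
    (intro unitary exp_scaleR_in assms)

text \<open>A chord is at most as long as its arc: the arc is cut into equal pieces, whose chords
  have total length tending to \<open>norm X\<close>.\<close>

lemma norm_exp_minus_one_le:
  assumes "X \<in> lie_algebra G"
  shows "norm (matrix_exp X - mat 1) \<le> norm X"
proof (rule LIMSEQ_le_const)
  let ?e = "\<lambda>m. matrix_exp (inverse (real (Suc m)) *\<^sub>R X)"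
  show "(\<lambda>m. norm (real (Suc m) *\<^sub>R (?e m - mat 1))) \<longlonglongrightarrow> norm X"
    by (intro tendsto_norm matrix_exp_difference_quotient filterlim_real_Suc)
  have one: "matrix_power (mat 1) m = (mat 1 :: complex^'n^'n)" for m
    by (induction m) simp_all
  have "norm (matrix_exp X - mat 1) \<le> norm (real (Suc m) *\<^sub>R (?e m - mat 1))" for m
  proof -
    have "matrix_power (?e m) (Suc m) = matrix_exp X"
      unfolding matrix_exp_power by (simp del: of_nat_Suc)
    then show ?thesis
      using norm_unitary_power_diff[of "?e m" "mat 1" "Suc m"]
        unitary[OF exp_scaleR_in[OF assms]] unitary_one
      by (simp only: one norm_scaleR abs_of_nat) blast
  qed
  then show "\<exists>N. \<forall>m\<ge>N. norm (matrix_exp X - mat 1) \<le> norm (real (Suc m) *\<^sub>R (?e m - mat 1))"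
    by blast
qed

section \<open>The adjoint action and the bracket\<close>

lemma conj_exp:
  assumes "g \<in> G"
  shows "matrix_exp (g ** X ** adjoint_matrix g) = g ** matrix_exp X ** adjoint_matrix g"
proof -
  have "g ** X = (g ** X ** adjoint_matrix g) ** g"
    using adjoint_mult_self[OF assms] by (simp add: matrix_mul_assoc[symmetric])
  from matrix_exp_intertwine[OF this]
  have "g ** matrix_exp X ** adjoint_matrix g
      = matrix_exp (g ** X ** adjoint_matrix g) ** (g ** adjoint_matrix g)"
    by (simp only: matrix_mul_assoc)
  then show ?thesis using mult_adjoint_self[OF assms] by simp
qed

lemma lie_conj:
  assumes "g \<in> G" "X \<in> lie_algebra G"
  shows "g ** X ** adjoint_matrix g \<in> lie_algebra G"
proof -
  have "t *\<^sub>R (g ** X ** adjoint_matrix g) = g ** (t *\<^sub>R X) ** adjoint_matrix g" for t :: real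
    by (simp add: matrix_mult.scaleR_left matrix_mult.scaleR_right)
  then show ?thesis
    unfolding lie_algebra_def
    by (simp add: conj_exp assms mult_in adjoint_in exp_scaleR_in)
qed

text \<open>The bracket is the derivative at 0 of the conjugates of \<open>X\<close> by the
  one-parameter group of \<open>Z\<close>. The difference quotients lie in the subspace
  \<open>lie_algebra G\<close>, which is closed.\<close>

lemma lie_bracket:
  assumes Z: "Z \<in> lie_algebra G" and X: "X \<in> lie_algebra G"
  shows "Z ** X - X ** Z \<in> lie_algebra G"
proof (rule closed_sequentially[OF closed_lie])
  let ?e = "\<lambda>m. matrix_exp (inverse (real (Suc m)) *\<^sub>R Z)"
  let ?c = "\<lambda>m. real (Suc m)"
  have eG: "?e m \<in> G" for m by (intro exp_scaleR_in Z)
  show "?c m *\<^sub>R (?e m ** X ** adjoint_matrix (?e m) - X) \<in> lie_algebra G" for m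
    by (intro lie_scaleR subspace_diff[OF subspace_lie] lie_conj eG X)
  have 1: "(\<lambda>m. ?c m *\<^sub>R (?e m - mat 1)) \<longlonglongrightarrow> Z"
    by (rule matrix_exp_difference_quotient[OF filterlim_real_Suc])
  have "(\<lambda>m. (?c m *\<^sub>R (?e m - mat 1)) ** X ** adjoint_matrix (?e m)
      + X ** adjoint_matrix (?c m *\<^sub>R (?e m - mat 1)))
    \<longlonglongrightarrow> Z ** X ** adjoint_matrix (mat 1) + X ** adjoint_matrix Z"
    by (intro tendsto_add matrix_mult.tendsto tendsto_const tendsto_adjoint 1
        tendsto_one_of_scaled[OF filterlim_real_Suc 1])
  moreover have "(?c m *\<^sub>R (?e m - mat 1)) ** X ** adjoint_matrix (?e m)
      + X ** adjoint_matrix (?c m *\<^sub>R (?e m - mat 1))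
      = ?c m *\<^sub>R (?e m ** X ** adjoint_matrix (?e m) - X)" for m
    by (simp only: matrix_mult.scaleR_left matrix_mult.scaleR_right adjoint_scaleR
        scaleR_add_right[symmetric])
      (simp add: matrix_mult.diff_left matrix_mult.diff_right adjoint_diff)
  ultimately show "(\<lambda>m. ?c m *\<^sub>R (?e m ** X ** adjoint_matrix (?e m) - X)) \<longlonglongrightarrow> Z ** X - X ** Z"
    by (simp add: lie_skew[OF Z] matrix_mult.minus_right)
qed

section \<open>Orthogonality to the Lie algebra and critical points of distances\<close>

lemma inner_lie_one: "X \<in> lie_algebra G \<Longrightarrow> inner X (mat 1) = 0"
  using inner_adjoint[of X "mat 1"] by (simp add: lie_skew)

lemma inner_lie_adjoint: "X \<in> lie_algebra G \<Longrightarrow> inner X (adjoint_matrix g) = - inner X g"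
  using inner_adjoint[of X "adjoint_matrix g"] by (simp add: lie_skew)

text \<open>Normalised differences of distinct elements close to the identity accumulate at nonzero
  elements of the Lie algebra.\<close>
lemma lie_separates_near_one:
  obtains d where "d > 0"
    "\<And>g h. \<lbrakk>g \<in> G; h \<in> G; norm (g - mat 1) < d; norm (h - mat 1) < d;
      \<And>Z. Z \<in> lie_algebra G \<Longrightarrow> inner Z (g - h) = 0\<rbrakk> \<Longrightarrow> g = h"
proof -
  have "\<exists>d>0. \<forall>g h. g \<in> G \<longrightarrow> h \<in> G \<longrightarrow> norm (g - mat 1) < d \<longrightarrow> norm (h - mat 1) < d \<longrightarrow>
      (\<forall>Z\<in>lie_algebra G. inner Z (g - h) = 0) \<longrightarrow> g = h"
  proof (rule ccontr)
    assume "\<not> ?thesis"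
    then have "\<forall>m. \<exists>g h. g \<in> G \<and> h \<in> G \<and> norm (g - mat 1) < inverse (real (Suc m)) \<and>
        norm (h - mat 1) < inverse (real (Suc m)) \<and> (\<forall>Z\<in>lie_algebra G. inner Z (g - h) = 0) \<and> g \<noteq> h"
      by (metis inverse_positive_iff_positive of_nat_0_less_iff zero_less_Suc)
    then obtain g h where g: "\<And>m. g m \<in> G" and h: "\<And>m. h m \<in> G"
      and g1: "\<And>m. norm (g m - mat 1) < inverse (real (Suc m))"
      and h1: "\<And>m. norm (h m - mat 1) < inverse (real (Suc m))"
      and orth: "\<And>m Z. Z \<in> lie_algebra G \<Longrightarrow> inner Z (g m - h m) = 0" and ne: "\<And>m. g m \<noteq> h m"
      by metis
    have lim1: "f \<longlonglongrightarrow> mat 1" if "\<And>m. norm (f m - mat 1) < inverse (real (Suc m))"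
      for f :: "nat \<Rightarrow> complex^'n^'n"
    proof -
      have "(\<lambda>m. f m - mat 1) \<longlonglongrightarrow> 0"
        by (rule Lim_null_comparison[OF _ LIMSEQ_inverse_real_of_nat])
          (simp add: that less_imp_le del: of_nat_Suc)
      then show ?thesis by (simp add: LIM_zero_iff)
    qed
    \<comment> \<open>Left translation by the inverse of \<open>h m\<close> moves the pair to the
      identity, where differences become tangent vectors; \<open>c m\<close> normalises them to the
      compact unit sphere.\<close>
    define k where "k m = adjoint_matrix (h m) ** g m" for m
    define c where "c m = inverse (norm (k m - mat 1))" for m
    define y where "y m = c m *\<^sub>R (k m - mat 1)" for m
    have kG: "k m \<in> G" for m unfolding k_def by (intro mult_in adjoint_in g h)
    have hk: "h m ** k m = g m" for m
      unfolding k_def by (simp add: matrix_mul_assoc mult_adjoint_self[OF h])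
    have k1: "k m \<noteq> mat 1" for m using hk[of m] ne[of m] by auto
    have "(\<lambda>m. k m) \<longlonglongrightarrow> adjoint_matrix (mat 1) ** mat 1"
      unfolding k_def by (intro matrix_mult.tendsto tendsto_adjoint lim1 g1 h1)
    then have "(\<lambda>m. norm (k m - mat 1)) \<longlonglongrightarrow> norm (mat 1 - mat 1 :: complex^'n^'n)"
      by (intro tendsto_norm tendsto_diff tendsto_const) simp
    then have c: "filterlim c at_top sequentially"
      unfolding c_def using k1 by (intro filterlim_inverse_at_top) auto
    have "y m \<in> sphere 0 1" for m
      using k1[of m] by (simp add: y_def c_def)
    then obtain X r where X: "X \<in> sphere 0 1" and r: "strict_mono r" and yr: "(y \<circ> r) \<longlonglongrightarrow> X"
      using compact_sphere[of 0 1] unfolding compact_def by metis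
    have cr: "filterlim (\<lambda>m. c (r m)) at_top sequentially"
      using filterlim_compose[OF c filterlim_subseq[OF r]] .
    have XL: "X \<in> lie_algebra G"
      by (rule lie_of_tangent[OF kG cr]) (use yr in \<open>simp add: y_def o_def\<close>)
    \<comment> \<open>The orthogonality is applied to the limit direction \<open>X\<close> itself;
      in the limit it reads \<open>inner X X = 0\<close>.\<close>
    have "inner X (h m ** y m) = 0" for m
    proof -
      have "h m ** y m = c m *\<^sub>R (g m - h m)"
        unfolding y_def by (simp add: matrix_mult.scaleR_right matrix_mult.diff_right hk)
      then show ?thesis using orth[OF XL] by simp
    qed
    moreover have "(\<lambda>m. inner X (h (r m) ** (y \<circ> r) m)) \<longlonglongrightarrow> inner X (mat 1 ** X)"
      using LIMSEQ_subseq_LIMSEQ[OF lim1[OF h1] r]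
      by (intro tendsto_inner tendsto_const matrix_mult.tendsto yr) (simp add: o_def)
    ultimately have "inner X X = 0"
      by (simp add: LIMSEQ_const_iff)
    then show False using X by simp
  qed
  then show thesis using that by blast
qed

text \<open>First-order condition for moving \<open>matrix_exp (t *\<^sub>R Z)\<close> into one
  factor and its inverse into the next, as needed for chains. With \<open>Q = 0\<close> it is the
  condition at a nearest point.\<close>

lemma stationary:
  assumes e: "e > 0"
    and max: "\<And>t. \<bar>t\<bar> < e \<Longrightarrow>
      inner P (A ** matrix_exp (t *\<^sub>R Z)) + inner Q (matrix_exp (- t *\<^sub>R Z) ** B)
      \<le> inner P A + inner Q B"
  shows "inner P (A ** Z) = inner Q (Z ** B)"
proof -
  let ?f = "\<lambda>t. inner P (A ** matrix_exp (t *\<^sub>R Z)) + inner Q (matrix_exp (t *\<^sub>R (- Z)) ** B)"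
  have "(?f has_vector_derivative
      (inner P (A ** (matrix_exp (0 *\<^sub>R Z) ** Z)) + inner Q ((matrix_exp (0 *\<^sub>R (- Z)) ** - Z) ** B)))
      (at 0)"
    by (intro has_vector_derivative_add matrix_exp_has_vector_derivative
        bounded_linear.has_vector_derivative[OF bounded_linear_inner_right]
        bounded_linear.has_vector_derivative[OF matrix_mult.bounded_linear_left]
        bounded_linear.has_vector_derivative[OF matrix_mult.bounded_linear_right])
  then have "DERIV ?f 0 :> inner P (A ** Z) - inner Q (Z ** B)"
    by (simp add: has_real_derivative_iff_has_vector_derivative matrix_mult.minus_left
        matrix_mult.minus_right)
  then have "inner P (A ** Z) - inner Q (Z ** B) = 0"
    by (rule DERIV_local_max[where d = e]) (use max e in simp_all)
  then show ?thesis by simp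
qed

text \<open>All of \<open>G\<close> lies on one sphere, so minimising a distance is maximising an
  inner product, which is the form required by \<open>stationary\<close>.\<close>

lemma norm_diff_unitary:
  assumes "g \<in> G" "h \<in> G"
  shows "(norm (g - h))\<^sup>2 = 2 * (norm (mat 1 :: complex^'n^'n))\<^sup>2 - 2 * inner g h"
proof -
  have "(norm (g - h))\<^sup>2 = (norm g)\<^sup>2 + (norm h)\<^sup>2 - 2 * inner g h"
    by (simp add: power2_norm_eq_inner inner_diff_left inner_diff_right inner_commute)
  then show ?thesis
    using norm_unitary[OF unitary] assms by simp
qed

text \<open>Criticality makes \<open>adjoint_matrix a ** g\<close> orthogonal to the Lie algebra. So
  is the identity, by skewness, and \<open>lie_separates_near_one\<close> identifies the two. The
  radius is the same at every \<open>a\<close>.\<close>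

lemma critical_distance:
  obtains d where "d > 0"
    "\<And>g a. \<lbrakk>g \<in> G; a \<in> G; dist g a < d;
      \<And>Z. Z \<in> lie_algebra G \<Longrightarrow>
        \<exists>e>0. \<forall>t. \<bar>t\<bar> < e \<longrightarrow> dist g a \<le> dist g (a ** matrix_exp (t *\<^sub>R Z))\<rbrakk> \<Longrightarrow> g = a"
proof -
  obtain d where d: "d > 0"
    "\<And>g h. \<lbrakk>g \<in> G; h \<in> G; norm (g - mat 1) < d; norm (h - mat 1) < d;
      \<And>Z. Z \<in> lie_algebra G \<Longrightarrow> inner Z (g - h) = 0\<rbrakk> \<Longrightarrow> g = h"
    using lie_separates_near_one by blast
  have "g = a" if gG: "g \<in> G" and aG: "a \<in> G" and ga: "dist g a < d"
    and min: "\<And>Z. Z \<in> lie_algebra G \<Longrightarrow>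
        \<exists>e>0. \<forall>t. \<bar>t\<bar> < e \<longrightarrow> dist g a \<le> dist g (a ** matrix_exp (t *\<^sub>R Z))" for g a
  proof -
    let ?k = "adjoint_matrix a ** g"
    have "inner Z (?k - mat 1) = 0" if Z: "Z \<in> lie_algebra G" for Z
    proof -
      obtain e where e: "e > 0"
        "\<And>t. \<bar>t\<bar> < e \<Longrightarrow> dist g a \<le> dist g (a ** matrix_exp (t *\<^sub>R Z))"
        using min[OF Z] by blast
      have "inner g (a ** Z) = inner 0 (Z ** mat 1)"
      proof (rule stationary[OF e(1)])
        fix t :: real
        assume "\<bar>t\<bar> < e"
        then have "(norm (g - a))\<^sup>2 \<le> (norm (g - a ** matrix_exp (t *\<^sub>R Z)))\<^sup>2"
          using e(2) by (simp add: dist_norm)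
        then show "inner g (a ** matrix_exp (t *\<^sub>R Z)) + inner 0 (matrix_exp (- t *\<^sub>R Z) ** mat 1)
            \<le> inner g a + inner 0 (mat 1)"
          by (simp add: norm_diff_unitary gG aG mult_in exp_scaleR_in Z)
      qed
      then have "inner (a ** Z) g = 0" by (simp add: inner_commute)
      then show ?thesis by (simp add: inner_mult_left inner_diff_right inner_lie_one[OF Z])
    qed
    moreover have "norm (?k - mat 1) < d"
    proof -
      have "?k - mat 1 = adjoint_matrix a ** (g - a)"
        by (simp add: matrix_mult.diff_right adjoint_mult_self[OF aG])
      then have "norm (?k - mat 1) = dist g a"
        by (simp add: norm_unitary_left unitary adjoint_in aG dist_norm)
      then show ?thesis using ga by simp
    qed
    ultimately have "?k = mat 1"
      using d(1) by (intro d(2)) (auto simp: mult_in adjoint_in aG gG one_in)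
    then have "a ** ?k = a" by simp
    then show ?thesis by (simp add: matrix_mul_assoc mult_adjoint_self[OF aG])
  qed
  then show thesis using that d(1) by blast
qed

text \<open>The uniform radius of \<open>critical_distance\<close> puts a relative ball about each
  point of the closure inside the closure, which is therefore open and closed in the connected set
  \<open>G\<close>.\<close>

lemma closure_exp_invariant_eq:
  assumes conn: "connected G" and C: "C \<subseteq> G" "C \<noteq> {}"
    and inv: "\<And>c Z. c \<in> C \<Longrightarrow> Z \<in> lie_algebra G \<Longrightarrow> c ** matrix_exp Z \<in> C"
  shows "closure C = G"
proof -
  have CG: "closure C \<subseteq> G"
    using C(1) closed_G by (rule closure_minimal)
  \<comment> \<open>A nearest point is available only in the closure, so the invariance has to be
    carried over to it.\<close>
  have cinv: "c ** matrix_exp Z \<in> closure C" if c: "c \<in> closure C" and Z: "Z \<in> lie_algebra G" for c Z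
  proof -
    obtain f where f: "\<And>m. f m \<in> C" "f \<longlonglongrightarrow> c"
      using c by (auto simp: closure_sequential)
    then have "(\<lambda>m. f m ** matrix_exp Z) \<longlonglongrightarrow> c ** matrix_exp Z"
      by (intro matrix_mult.tendsto tendsto_const)
    moreover have "f m ** matrix_exp Z \<in> C" for m
      using f(1) Z by (rule inv)
    ultimately show ?thesis
      unfolding closure_sequential by (intro exI[of _ "\<lambda>m. f m ** matrix_exp Z"]) simp
  qed
  obtain d where d: "d > 0"
    "\<And>g a. \<lbrakk>g \<in> G; a \<in> G; dist g a < d;
      \<And>Z. Z \<in> lie_algebra G \<Longrightarrow>
        \<exists>e>0. \<forall>t. \<bar>t\<bar> < e \<longrightarrow> dist g a \<le> dist g (a ** matrix_exp (t *\<^sub>R Z))\<rbrakk> \<Longrightarrow> g = a"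
    using critical_distance by blast
  have near: "g \<in> closure C" if c: "c \<in> closure C" and g: "g \<in> G" and cg: "dist g c < d" for c g
  proof -
    obtain a where a: "a \<in> closure C" and min: "\<And>y. y \<in> closure C \<Longrightarrow> dist g a \<le> dist g y"
      using distance_attains_inf[of "closure C" g] C by auto
    have "g = a"
    proof (rule d(2))
      show "a \<in> G" using a CG by blast
      show "dist g a < d" using min[OF c] cg by simp
      show "\<exists>e>0. \<forall>t. \<bar>t\<bar> < e \<longrightarrow> dist g a \<le> dist g (a ** matrix_exp (t *\<^sub>R Z))"
        if "Z \<in> lie_algebra G" for Z
        using min cinv[OF a lie_scaleR[OF that]] by (intro exI[of _ 1]) simp
    qed (rule g)
    then show ?thesis using a by simp
  qed
  have "openin (top_of_set G) (closure C)"
    unfolding openin_contains_ball using near d(1) CG by (auto simp: dist_commute intro!: exI[of _ d])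
  moreover have "closedin (top_of_set G) (closure C)"
    using CG by (simp add: closed_subset)
  ultimately show ?thesis
    using conn C(2) by (auto simp: connected_clopen)
qed

end

section \<open>Products of exponentials are exponentials\<close>

text \<open>Tychonoff's theorem for an arbitrary index type: it serves chains, indexed by
  \<open>nat\<close>, and functionals, indexed by test functions.\<close>

lemma compact_functions:
  fixes S :: "'i \<Rightarrow> 'a::topological_space set"
  assumes "\<And>i. compact (S i)"
  shows "compact {f. \<forall>i. f i \<in> S i}"
proof -
  have "compactin (product_topology (\<lambda>i. euclidean) UNIV) (PiE UNIV S)"
    using assms by (simp add: compactin_PiE)
  moreover have "PiE UNIV S = {f. \<forall>i. f i \<in> S i}"
    by auto
  ultimately show ?thesis
    by (simp add: euclidean_product_topology)
qed

text \<open>Chains are functions on all of \<open>nat\<close> of which only the first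
  \<open>m\<close> values count, so that the chains in \<open>G\<close> form a compact product
  space.\<close>

primrec chain_product :: "(nat \<Rightarrow> complex^'n^'n) \<Rightarrow> nat \<Rightarrow> complex^'n^'n" where
  "chain_product f 0 = mat 1"
| "chain_product f (Suc m) = chain_product f m ** f m"

lemma chain_product_cong:
  "(\<And>i. i < m \<Longrightarrow> f i = f' i) \<Longrightarrow> chain_product f m = chain_product f' m"
  by (induction m) auto

lemma chain_product_const: "chain_product (\<lambda>i. g) m = matrix_power g m"
proof -
  have "matrix_power g m ** g = g ** matrix_power g m" for m
    by (induction m) (simp_all add: matrix_mul_assoc[symmetric])
  then show ?thesis by (induction m) simp_all
qed

lemma continuous_chain_product: "continuous_on UNIV (\<lambda>f. chain_product f m)"
  by (induction m) (auto intro!: continuous_intros matrix_mult.continuous_on)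

context compact_unitary_group
begin

inductive_set exp_products :: "(complex^'n^'n) set" where
  one: "mat 1 \<in> exp_products"
| step: "g \<in> exp_products \<Longrightarrow> X \<in> lie_algebra G \<Longrightarrow> g ** matrix_exp X \<in> exp_products"

lemma exp_products_subset: "g \<in> exp_products \<Longrightarrow> g \<in> G"
  by (induction rule: exp_products.induct) (auto simp: one_in mult_in exp_in)

lemma closure_exp_products: "connected G \<Longrightarrow> closure exp_products = G"
  using exp_products_subset exp_products.one exp_products.step
  by (intro closure_exp_invariant_eq) auto

text \<open>Each exponential is cut into \<open>M\<close> equal links of length at most
  \<open>norm X / real M\<close>, so it contributes at most \<open>(norm X)\<^sup>2 / real M\<close>
  to the energy. The total energy decays in \<open>M\<close>, while the number of links grows
  linearly.\<close>

lemma exp_products_chain: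
  assumes "g \<in> exp_products"
  shows "\<exists>k S. k \<ge> 1 \<and> (\<forall>M\<ge>1. \<exists>f. (\<forall>i. f i \<in> G) \<and> chain_product f (k * M) = g \<and>
    (\<Sum>i<k * M. (norm (f i - mat 1))\<^sup>2) \<le> S / real M)"
  using assms
proof induction
  case one
  show ?case
    \<comment> \<open>The empty product counts as one constant factor with \<open>S = 0\<close>;
      this keeps \<open>k\<close> positive, so that \<open>k * M\<close> tends to infinity with
      \<open>M\<close>.\<close>
    by (intro exI[of _ 1] exI[of _ 0] conjI allI impI exI[of _ "\<lambda>i. mat 1"])
      (use one_in in \<open>simp_all add: power_in chain_product_const del: funpow.simps, induct_tac M, simp_all\<close>)
next
  case (step g X)
  then obtain k S where k: "k \<ge> 1" and ch: "\<And>M. M \<ge> 1 \<Longrightarrow>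
    \<exists>f. (\<forall>i. f i \<in> G) \<and> chain_product f (k * M) = g \<and>
      (\<Sum>i<k * M. (norm (f i - mat 1))\<^sup>2) \<le> S / real M" by blast
  have "\<exists>f. (\<forall>i. f i \<in> G) \<and> chain_product f (Suc k * M) = g ** matrix_exp X \<and>
      (\<Sum>i<Suc k * M. (norm (f i - mat 1))\<^sup>2) \<le> (S + (norm X)\<^sup>2) / real M" if M: "M \<ge> 1" for M
  proof -
    obtain f where f: "\<And>i. f i \<in> G" "chain_product f (k * M) = g"
      "(\<Sum>i<k * M. (norm (f i - mat 1))\<^sup>2) \<le> S / real M"
      using ch[OF M] by blast
    let ?e = "matrix_exp ((1 / real M) *\<^sub>R X)"
    define f' where "f' i = (if i < k * M then f i else ?e)" for i
    have "chain_product f' (k * M) = g"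
      using f(2) chain_product_cong[of "k * M" f' f] by (simp add: f'_def)
    then have "chain_product f' (k * M + m) = g ** matrix_exp ((real m / real M) *\<^sub>R X)" for m
    proof (induction m)
      case (Suc m)
      have "real (Suc m) / real M = real m / real M + 1 / real M"
        by (simp add: add_divide_distrib)
      then have "matrix_exp ((real (Suc m) / real M) *\<^sub>R X)
          = matrix_exp ((real m / real M) *\<^sub>R X) ** ?e"
        by (simp only: matrix_exp_scaleR_add)
      then show ?case using Suc by (simp add: matrix_mul_assoc f'_def)
    qed simp
    from this[of M] have p: "chain_product f' (Suc k * M) = g ** matrix_exp X"
      using M by (simp add: add.commute)
    have "norm (?e - mat 1) \<le> norm X / real M"
      using norm_exp_minus_one_le[OF lie_scaleR[OF step.hyps(2)], of "1 / real M"] by simp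
    then have "(norm (?e - mat 1))\<^sup>2 \<le> (norm X / real M)\<^sup>2"
      by (rule power_mono) simp
    then have e: "real M * (norm (?e - mat 1))\<^sup>2 \<le> (norm X)\<^sup>2 / real M"
      using M by (simp add: power_divide field_simps power2_eq_square)
    have "(\<Sum>i<k * M + M. (norm (f' i - mat 1))\<^sup>2)
        = (\<Sum>i<k * M. (norm (f i - mat 1))\<^sup>2) + real M * (norm (?e - mat 1))\<^sup>2"
    proof -
      have "{..<k * M + M} = {..<k * M} \<union> {k * M..<k * M + M}" by auto
      then have "(\<Sum>i<k * M + M. (norm (f' i - mat 1))\<^sup>2)
        = (\<Sum>i<k * M. (norm (f' i - mat 1))\<^sup>2) + (\<Sum>i = k * M..<k * M + M. (norm (f' i - mat 1))\<^sup>2)"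
        by (simp add: sum.union_disjoint ivl_disj_int)
      then show ?thesis by (simp add: f'_def)
    qed
    then have "(\<Sum>i<Suc k * M. (norm (f' i - mat 1))\<^sup>2) \<le> (S + (norm X)\<^sup>2) / real M"
      using f(3) e by (simp add: add_divide_distrib add.commute)
    moreover have "\<forall>i. f' i \<in> G"
      using f(1) exp_scaleR_in[OF step.hyps(2)] by (simp add: f'_def)
    ultimately show ?thesis using p by blast
  qed
  then show ?case by (intro exI[of _ "Suc k"] exI[of _ "S + (norm X)\<^sup>2"]) auto
qed

text \<open>A chain of minimal energy with given product is critical under the variations
  \<open>f j \<mapsto> f j e\<^sup>t\<^sup>Z\<close>, \<open>f (j + 1) \<mapsto> e\<^sup>-\<^sup>t\<^sup>Z f (j + 1)\<close>, so that consecutive elements of it agree: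
  this is a discrete geodesic.\<close>
lemma minimal_chain_step:
  fixes f :: "nat \<Rightarrow> complex^'n^'n"
  assumes f: "\<And>i. f i \<in> G" and j: "Suc j < N"
    and min: "\<And>f'. (\<And>i. f' i \<in> G) \<Longrightarrow> chain_product f' N = chain_product f N \<Longrightarrow>
      (\<Sum>i<N. (norm (f i - mat 1))\<^sup>2) \<le> (\<Sum>i<N. (norm (f' i - mat 1))\<^sup>2)"
    and Z: "Z \<in> lie_algebra G"
  shows "inner Z (f j - f (Suc j)) = 0"
proof -
  have "inner (mat 1) (f j ** Z) = inner (mat 1) (Z ** f (Suc j))"
  proof (rule stationary[of 1])
    fix t :: real
    let ?a = "f j ** matrix_exp (t *\<^sub>R Z)" and ?b = "matrix_exp (- t *\<^sub>R Z) ** f (Suc j)"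
    define f' where "f' = f(j := ?a, Suc j := ?b)"
    have aG: "?a \<in> G" and bG: "?b \<in> G"
      by (intro mult_in exp_scaleR_in f Z)+
    have f'G: "f' i \<in> G" for i
      using aG bG f by (simp add: f'_def)
    have ab: "?a ** ?b = f j ** f (Suc j)"
    proof -
      have "matrix_exp (t *\<^sub>R Z) ** matrix_exp (- t *\<^sub>R Z) = mat 1"
        using matrix_exp_scaleR_add[of t "- t" Z] by simp
      then have "?a ** ?b = f j ** mat 1 ** f (Suc j)"
        by (metis matrix_mul_assoc)
      then show ?thesis by simp
    qed
    have pj: "chain_product f' j = chain_product f j"
      by (rule chain_product_cong) (simp add: f'_def)
    have "chain_product f' (Suc (Suc j) + m) = chain_product f (Suc (Suc j) + m)" for m
    proof (induction m)
      case 0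
      have "chain_product f' (Suc (Suc j)) = chain_product f j ** (?a ** ?b)"
        by (simp only: chain_product.simps pj) (simp add: f'_def matrix_mul_assoc)
      then show ?case unfolding ab by (simp add: matrix_mul_assoc)
    next
      case (Suc m)
      then show ?case by (simp add: f'_def)
    qed
    moreover have "Suc (Suc j) + (N - Suc (Suc j)) = N"
      using j by simp
    ultimately have "chain_product f' N = chain_product f N"
      by metis
    then have le: "(\<Sum>i<N. (norm (f i - mat 1))\<^sup>2) \<le> (\<Sum>i<N. (norm (f' i - mat 1))\<^sup>2)"
      by (intro min f'G)
    have split: "(\<Sum>i<N. h i) = h j + (h (Suc j) + (\<Sum>i\<in>{..<N} - {j} - {Suc j}. h i))"
      for h :: "nat \<Rightarrow> real"
      using j by (subst sum.remove[of _ j]; simp) (subst sum.remove[of _ "Suc j"]; simp)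
    have "(\<Sum>i\<in>{..<N} - {j} - {Suc j}. (norm (f' i - mat 1))\<^sup>2)
        = (\<Sum>i\<in>{..<N} - {j} - {Suc j}. (norm (f i - mat 1))\<^sup>2)"
      by (rule sum.cong) (auto simp: f'_def)
    then have "(norm (f j - mat 1))\<^sup>2 + (norm (f (Suc j) - mat 1))\<^sup>2
        \<le> (norm (?a - mat 1))\<^sup>2 + (norm (?b - mat 1))\<^sup>2"
      using le unfolding split by (simp add: f'_def)
    then show "inner (mat 1) ?a + inner (mat 1) ?b \<le> inner (mat 1) (f j) + inner (mat 1) (f (Suc j))"
      by (simp add: norm_diff_unitary one_in aG bG f inner_commute[of "mat 1"] del: scaleR_minus_left)
  qed simp
  \<comment> \<open>Skewness of \<open>Z\<close> turns both sides into inner products with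
    \<open>Z\<close>, the form in which \<open>lie_separates_near_one\<close> applies.\<close>
  moreover have "inner (mat 1) (f j ** Z) = - inner Z (f j)"
    by (simp add: inner_commute[of "mat 1"] inner_mult_left inner_lie_adjoint[OF Z])
  moreover have "inner (mat 1) (Z ** f (Suc j)) = - inner Z (f (Suc j))"
    by (simp add: inner_commute[of "mat 1"] inner_mult_right inner_lie_adjoint[OF Z])
  ultimately show ?thesis by (simp add: inner_diff_right)
qed

lemma minimal_chain_exists:
  assumes "\<And>i. f0 i \<in> G"
  obtains f where "\<And>i. f i \<in> G" "chain_product f N = chain_product f0 N"
    "\<And>f'. (\<And>i. f' i \<in> G) \<Longrightarrow> chain_product f' N = chain_product f N \<Longrightarrow>
      (\<Sum>i<N. (norm (f i - mat 1))\<^sup>2) \<le> (\<Sum>i<N. (norm (f' i - mat 1))\<^sup>2)"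
proof -
  let ?P = "{f. \<forall>i. f i \<in> G} \<inter> {f. chain_product f N = chain_product f0 N}"
  have "closed {f. chain_product f N = chain_product f0 N}"
    by (intro closed_Collect_eq continuous_chain_product continuous_on_const)
  moreover have "compact {f :: nat \<Rightarrow> _. \<forall>i. f i \<in> G}"
    using compact_functions[OF compact_G] .
  ultimately have "compact ?P"
    by (rule compact_Int_closed[rotated])
  moreover have "?P \<noteq> {}" using assms by auto
  moreover have "continuous_on ?P (\<lambda>f. \<Sum>i<N. (norm (f i - mat 1))\<^sup>2)"
    by (intro continuous_intros continuous_on_subset[OF continuous_on_product_coordinates]) auto
  ultimately obtain f where "f \<in> ?P" "\<And>f'. f' \<in> ?P \<Longrightarrow>
      (\<Sum>i<N. (norm (f i - mat 1))\<^sup>2) \<le> (\<Sum>i<N. (norm (f' i - mat 1))\<^sup>2)"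
    using continuous_attains_inf[of ?P "\<lambda>f. \<Sum>i<N. (norm (f i - mat 1))\<^sup>2"] by blast
  then show thesis
    by (intro that[of f]) auto
qed

text \<open>The total energy bounds the square of each link of a minimal chain. Once
  \<open>M\<close> exceeds \<open>S / d\<^sup>2\<close>, all links lie where
  \<open>lie_separates_near_one\<close> turns criticality into equality of neighbours, and a
  constant chain multiplies to a power.\<close>

lemma exp_products_power:
  assumes "g \<in> exp_products"
  obtains k S M0 where "k \<ge> 1" "\<And>M. M \<ge> M0 \<Longrightarrow> M \<ge> 1 \<and> (\<exists>\<gamma>\<in>G. matrix_power \<gamma> (k * M) = g \<and>
    real (k * M) * (norm (\<gamma> - mat 1))\<^sup>2 \<le> S / real M)"
proof -
  obtain k S where k: "k \<ge> 1" and ch: "\<And>M. M \<ge> 1 \<Longrightarrow>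
    \<exists>f. (\<forall>i. f i \<in> G) \<and> chain_product f (k * M) = g \<and>
      (\<Sum>i<k * M. (norm (f i - mat 1))\<^sup>2) \<le> S / real M"
    using exp_products_chain[OF assms] by metis
  obtain d where d: "d > 0"
    "\<And>g h. \<lbrakk>g \<in> G; h \<in> G; norm (g - mat 1) < d; norm (h - mat 1) < d;
      \<And>Z. Z \<in> lie_algebra G \<Longrightarrow> inner Z (g - h) = 0\<rbrakk> \<Longrightarrow> g = h"
    using lie_separates_near_one by blast
  obtain M0 :: nat where M0: "S / d\<^sup>2 < real M0" "M0 \<ge> 1"
    using reals_Archimedean2[of "max 1 (S / d\<^sup>2)"] by auto
  have "\<exists>\<gamma>\<in>G. matrix_power \<gamma> (k * M) = g \<and> real (k * M) * (norm (\<gamma> - mat 1))\<^sup>2 \<le> S / real M"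
    if M: "M \<ge> M0" for M
  proof -
    have M1: "M \<ge> 1" using M M0 by simp
    let ?N = "k * M"
    obtain f0 where f0: "\<And>i. f0 i \<in> G" "chain_product f0 ?N = g"
      "(\<Sum>i<?N. (norm (f0 i - mat 1))\<^sup>2) \<le> S / real M"
      using ch[OF M1] by blast
    obtain f where f: "\<And>i. f i \<in> G" and fp: "chain_product f ?N = chain_product f0 ?N"
      and min: "\<And>f'. (\<And>i. f' i \<in> G) \<Longrightarrow> chain_product f' ?N = chain_product f ?N \<Longrightarrow>
      (\<Sum>i<?N. (norm (f i - mat 1))\<^sup>2) \<le> (\<Sum>i<?N. (norm (f' i - mat 1))\<^sup>2)"
      using minimal_chain_exists[of f0 ?N] f0(1) by blast
    have E: "(\<Sum>i<?N. (norm (f i - mat 1))\<^sup>2) \<le> S / real M"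
      using min[OF f0(1)] fp f0(3) by fastforce
    have small: "norm (f i - mat 1) < d" if "i < ?N" for i
    proof -
      have "(norm (f i - mat 1))\<^sup>2 \<le> (\<Sum>i<?N. (norm (f i - mat 1))\<^sup>2)"
        using that by (intro member_le_sum) auto
      also have "\<dots> \<le> S / real M" by (rule E)
      also have "\<dots> < d\<^sup>2"
      proof -
        have "S / d\<^sup>2 < real M" using M0(1) M by (meson less_le_trans of_nat_le_iff)
        then show ?thesis using d(1) M1 by (simp add: field_simps)
      qed
      finally show ?thesis using d(1) by (simp add: power2_less_imp_less)
    qed
    have "f j = f (Suc j)" if j: "Suc j < ?N" for j
    proof (rule d(2)[OF f f])
      show "norm (f j - mat 1) < d" "norm (f (Suc j) - mat 1) < d"
        using j by (intro small; simp)+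
      show "inner Z (f j - f (Suc j)) = 0" if "Z \<in> lie_algebra G" for Z
        by (rule minimal_chain_step[OF f j min that])
    qed
    then have const: "i < ?N \<Longrightarrow> f i = f 0" for i
      by (induction i) (simp, metis Suc_lessD)
    have "chain_product f ?N = matrix_power (f 0) ?N"
      using chain_product_cong[of ?N f "\<lambda>i. f 0"] const by (simp add: chain_product_const)
    moreover have "(\<Sum>i<?N. (norm (f i - mat 1))\<^sup>2) = real ?N * (norm (f 0 - mat 1))\<^sup>2"
      using const by simp
    ultimately show ?thesis
      using f[of 0] fp f0(2) E by metis
  qed
  then show thesis using M0(2) by (intro that[OF k, of M0]) auto
qed

text \<open>The difference of the link and the identity, scaled by the number of links, has squared
  norm equal to that number times the energy, so at most \<open>k * S\<close> for every
  \<open>M\<close>. A cluster point \<open>Y\<close> is tangent to \<open>G\<close>, and the powers,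
  all equal to \<open>g\<close>, tend to \<open>matrix_exp Y\<close>.\<close>

theorem exp_products_exp:
  assumes "g \<in> exp_products"
  obtains Y where "Y \<in> lie_algebra G" "g = matrix_exp Y"
proof -
  obtain k S M0 where k: "k \<ge> 1" and M0: "\<And>M. M \<ge> M0 \<Longrightarrow> M \<ge> 1 \<and> (\<exists>\<gamma>\<in>G. matrix_power \<gamma> (k * M) = g \<and>
    real (k * M) * (norm (\<gamma> - mat 1))\<^sup>2 \<le> S / real M)"
    using exp_products_power[OF assms] by metis
  define N where "N m = k * (M0 + m)" for m
  define c where "c m = real (N m)" for m
  have "\<exists>\<gamma>. \<gamma> \<in> G \<and> matrix_power \<gamma> (N m) = g \<and> norm (c m *\<^sub>R (\<gamma> - mat 1)) \<le> sqrt (real k * S)" for m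
  proof -
    let ?M = "M0 + m"
    have M1: "?M \<ge> 1" using M0[of ?M] by simp
    obtain \<gamma> where \<gamma>: "\<gamma> \<in> G" "matrix_power \<gamma> (N m) = g"
      "real (N m) * (norm (\<gamma> - mat 1))\<^sup>2 \<le> S / real ?M"
      using M0[of ?M] unfolding N_def by auto
    have "(norm (c m *\<^sub>R (\<gamma> - mat 1)))\<^sup>2 = c m * (real (N m) * (norm (\<gamma> - mat 1))\<^sup>2)"
      by (simp add: c_def power_mult_distrib power2_eq_square)
    also have "\<dots> \<le> c m * (S / real ?M)"
      using \<gamma>(3) by (intro mult_left_mono) (auto simp: c_def)
    also have "\<dots> = real k * S"
      using M1 by (simp add: c_def N_def field_simps)
    finally have "norm (c m *\<^sub>R (\<gamma> - mat 1)) \<le> sqrt (real k * S)"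
      by (rule real_le_rsqrt)
    then show ?thesis using \<gamma> by blast
  qed
  then obtain \<gamma> where \<gamma>: "\<And>m. \<gamma> m \<in> G" "\<And>m. matrix_power (\<gamma> m) (N m) = g"
    "\<And>m. norm (c m *\<^sub>R (\<gamma> m - mat 1)) \<le> sqrt (real k * S)"
    by metis
  have "c m *\<^sub>R (\<gamma> m - mat 1) \<in> cball 0 (sqrt (real k * S))" for m
    using \<gamma>(3) by simp
  then obtain Y r where r: "strict_mono r" and Y: "((\<lambda>m. c m *\<^sub>R (\<gamma> m - mat 1)) \<circ> r) \<longlonglongrightarrow> Y"
    using compact_cball[of 0 "sqrt (real k * S)"] unfolding compact_def
    by (metis (no_types, lifting))
  have "filterlim c at_top sequentially"
  proof (rule filterlim_at_top_mono[OF filterlim_real_sequentially])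
    show "\<forall>\<^sub>F m in sequentially. real m \<le> c m"
    proof (intro always_eventually allI)
      fix m
      have "1 * m \<le> k * (M0 + m)"
        using k by (intro mult_le_mono) auto
      then show "real m \<le> c m"
        unfolding c_def N_def of_nat_le_iff by simp
    qed
  qed
  then have cr: "filterlim (\<lambda>m. c (r m)) at_top sequentially"
    using filterlim_compose filterlim_subseq[OF r] by blast
  have Y': "(\<lambda>m. c (r m) *\<^sub>R (\<gamma> (r m) - mat 1)) \<longlonglongrightarrow> Y"
    using Y by (simp add: o_def)
  have "\<forall>\<^sub>F m in sequentially. 0 < c (r m)"
    using eventually_compose_filterlim[OF eventually_gt_at_top[of 0] cr] .
  then have "\<forall>\<^sub>F m in sequentially. 1 = real (N (r m)) / c (r m)"
    by eventually_elim (simp add: c_def)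
  then have "(\<lambda>m. real (N (r m)) / c (r m)) \<longlonglongrightarrow> 1"
    by (rule Lim_transform_eventually[OF tendsto_const])
  from unitary_power_tendsto_exp[OF unitary[OF \<gamma>(1)] cr Y' this]
  have "g = matrix_exp Y"
    by (simp add: \<gamma>(2) LIMSEQ_const_iff)
  moreover have "Y \<in> lie_algebra G"
    using lie_of_tangent[OF \<gamma>(1) cr Y'] .
  ultimately show thesis by (rule that[rotated])
qed

end

section \<open>The exponential map of a torus\<close>

context compact_unitary_group
begin

lemma commute_of_commute_exp:
  assumes "\<And>t. h ** matrix_exp (t *\<^sub>R X) = matrix_exp (t *\<^sub>R X) ** h"
  shows "h ** X = X ** h"
proof (rule LIMSEQ_unique)
  let ?y = "\<lambda>m. real (Suc m) *\<^sub>R (matrix_exp (inverse (real (Suc m)) *\<^sub>R X) - mat 1)"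
  have y: "?y \<longlonglongrightarrow> X"
    by (rule matrix_exp_difference_quotient[OF filterlim_real_Suc])
  show "(\<lambda>m. h ** ?y m) \<longlonglongrightarrow> h ** X"
    by (intro matrix_mult.tendsto tendsto_const y)
  have "h ** ?y m = ?y m ** h" for m
    by (simp add: matrix_mult.scaleR_left matrix_mult.scaleR_right matrix_mult.diff_left
        matrix_mult.diff_right assms)
  moreover have "(\<lambda>m. ?y m ** h) \<longlonglongrightarrow> X ** h"
    by (intro matrix_mult.tendsto tendsto_const y)
  ultimately show "(\<lambda>m. h ** ?y m) \<longlonglongrightarrow> X ** h" by simp
qed

lemma exp_commute_of_commute: "h ** X = X ** h \<Longrightarrow> h ** matrix_exp (t *\<^sub>R X) = matrix_exp (t *\<^sub>R X) ** h"
  by (rule matrix_exp_intertwine) (simp add: matrix_mult.scaleR_left matrix_mult.scaleR_right)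

lemma lie_commute:
  assumes comm: "\<And>g h. g \<in> G \<Longrightarrow> h \<in> G \<Longrightarrow> g ** h = h ** g"
    and X: "X \<in> lie_algebra G" and Y: "Y \<in> lie_algebra G"
  shows "X ** Y = Y ** X"
proof (rule commute_of_commute_exp)
  fix t
  have "matrix_exp (t *\<^sub>R Y) ** X = X ** matrix_exp (t *\<^sub>R Y)"
    by (rule commute_of_commute_exp) (intro comm exp_scaleR_in X Y)
  then show "X ** matrix_exp (t *\<^sub>R Y) = matrix_exp (t *\<^sub>R Y) ** X" by simp
qed

text \<open>If \<open>matrix_exp X\<close> were the identity, the inner product of \<open>X\<close>
  with \<open>matrix_exp (t *\<^sub>R X)\<close> would have a critical point in (0, 1). Its
  derivative differs from the square of \<open>norm X\<close> by at most \<open>K\<close> times the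
  cube, which is half that square for \<open>r = 1 / (2 * K)\<close>.\<close>

lemma exp_eq_one_imp_norm_ge:
  obtains r where "r > 0"
    "\<And>X. X \<in> lie_algebra G \<Longrightarrow> norm X = r \<Longrightarrow> matrix_exp X \<noteq> mat 1"
proof -
  obtain K where K: "K > 0"
    "\<And>(A :: complex^'n^'n) (B :: complex^'n^'n). norm (A ** B) \<le> norm A * norm B * K"
    using matrix_mult.pos_bounded by blast
  define r where "r = 1 / (2 * K)"
  have "matrix_exp X \<noteq> mat 1" if X: "X \<in> lie_algebra G" and r: "norm X = r" for X
  proof
    assume e1: "matrix_exp X = mat 1"
    let ?g = "\<lambda>t. inner X (matrix_exp (t *\<^sub>R X))"
    have "DERIV ?g t :> inner X (matrix_exp (t *\<^sub>R X) ** X)" for t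
      unfolding has_real_derivative_iff_has_vector_derivative
      by (intro bounded_linear.has_vector_derivative[OF bounded_linear_inner_right]
          matrix_exp_has_vector_derivative)
    then obtain s where s: "0 < s" "s < 1" and "?g 1 - ?g 0 = (1 - 0) * inner X (matrix_exp (s *\<^sub>R X) ** X)"
      using MVT2[of 0 1 ?g "\<lambda>t. inner X (matrix_exp (t *\<^sub>R X) ** X)"] by auto
    then have 0: "inner X (matrix_exp (s *\<^sub>R X) ** X) = 0"
      by (simp add: e1)
    have "\<bar>inner X ((matrix_exp (s *\<^sub>R X) - mat 1) ** X)\<bar>
        \<le> norm X * norm ((matrix_exp (s *\<^sub>R X) - mat 1) ** X)"
      by (rule Cauchy_Schwarz_ineq2)
    also have "\<dots> \<le> norm X * (norm (matrix_exp (s *\<^sub>R X) - mat 1) * norm X * K)"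
      using K(2)[of "matrix_exp (s *\<^sub>R X) - mat 1" X] by (intro mult_left_mono) auto
    also have "\<dots> \<le> norm X * (norm X * norm X * K)"
    proof (intro mult_left_mono mult_right_mono)
      have "norm (matrix_exp (s *\<^sub>R X) - mat 1) \<le> norm (s *\<^sub>R X)"
        by (rule norm_exp_minus_one_le[OF lie_scaleR[OF X]])
      also have "\<dots> \<le> norm X" using s by (simp add: mult_left_le_one_le)
      finally show "norm (matrix_exp (s *\<^sub>R X) - mat 1) \<le> norm X" .
    qed (use K in auto)
    also have "\<dots> = norm X * norm X / 2"
      using K(1) by (simp add: r r_def)
    finally have *: "\<bar>inner X (matrix_exp (s *\<^sub>R X) ** X) - norm X * norm X\<bar> \<le> norm X * norm X / 2"
      by (simp add: matrix_mult.diff_left inner_diff_right dot_square_norm power2_eq_square)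
    have "\<bar>a - b\<bar> \<le> b / 2 \<Longrightarrow> b / 2 \<le> a" for a b :: real
      by (simp add: abs_if split: if_splits)
    from this[OF *] have "inner X (matrix_exp (s *\<^sub>R X) ** X) \<ge> norm X * norm X / 2" .
    moreover have "norm X * norm X > 0" using K(1) by (simp add: r r_def)
    ultimately show False using 0 by simp
  qed
  then show thesis using K(1) by (intro that[of r]) (auto simp: r_def)
qed

text \<open>On the Lie algebra of a commutative group exp is a homomorphism, so its image is
  invariant and dense. It remains to see that it contains a neighbourhood of the identity.\<close>

theorem exp_surj_abelian:
  assumes conn: "connected G" and comm: "\<And>g h. g \<in> G \<Longrightarrow> h \<in> G \<Longrightarrow> g ** h = h ** g"
    and g: "g \<in> G"
  obtains X where "X \<in> lie_algebra G" "matrix_exp X = g"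
proof -
  let ?L = "lie_algebra G"
  have exp_add: "matrix_exp (X + Y) = matrix_exp X ** matrix_exp Y" if "X \<in> ?L" "Y \<in> ?L" for X Y
    by (rule matrix_exp_add[OF lie_commute[OF comm that]])
  have lip: "norm (matrix_exp X - matrix_exp Y) \<le> norm (X - Y)" if X: "X \<in> ?L" and Y: "Y \<in> ?L" for X Y
  proof -
    have XY: "X - Y \<in> ?L" by (intro subspace_diff[OF subspace_lie] X Y)
    have "matrix_exp X - matrix_exp Y = matrix_exp Y ** (matrix_exp (X - Y) - mat 1)"
      using exp_add[OF Y XY] by (simp add: matrix_mult.diff_right)
    then show ?thesis
      using norm_exp_minus_one_le[OF XY] by (simp add: norm_unitary_left unitary exp_in Y)
  qed
  have cont: "continuous_on S matrix_exp" if "S \<subseteq> ?L" for S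
    unfolding continuous_on_iff
    using lip that by (intro ballI allI impI exI) (auto simp: dist_norm subset_iff intro: le_less_trans)
  obtain r where r: "r > 0" "\<And>X. X \<in> ?L \<Longrightarrow> norm X = r \<Longrightarrow> matrix_exp X \<noteq> mat 1"
    using exp_eq_one_imp_norm_ge by blast
  \<comment> \<open>The least distance to the identity on the sphere of radius \<open>r\<close>. The
    sphere is empty when the Lie algebra is zero, and then any positive \<open>m\<close>
    serves.\<close>
  obtain m where m: "m > 0" "\<And>X. X \<in> ?L \<Longrightarrow> norm X = r \<Longrightarrow> m \<le> norm (matrix_exp X - mat 1)"
  proof (cases "sphere 0 r \<inter> ?L = {}")
    case True
    then show ?thesis by (intro that[of 1]) auto
  next
    case False
    have "compact (sphere 0 r \<inter> ?L)"
      by (intro compact_Int_closed compact_sphere closed_lie)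
    moreover have "continuous_on (sphere 0 r \<inter> ?L) (\<lambda>X. norm (matrix_exp X - mat 1))"
      by (intro continuous_intros cont) auto
    ultimately obtain X0 where "X0 \<in> sphere 0 r \<inter> ?L"
      "\<And>X. X \<in> sphere 0 r \<inter> ?L \<Longrightarrow> norm (matrix_exp X0 - mat 1) \<le> norm (matrix_exp X - mat 1)"
      using continuous_attains_inf[of "sphere 0 r \<inter> ?L" "\<lambda>X. norm (matrix_exp X - mat 1)"] False
      by blast
    then show ?thesis
      using r(2) by (intro that[of "norm (matrix_exp X0 - mat 1)"]) auto
  qed
  obtain d where d: "d > 0"
    "\<And>g a. \<lbrakk>g \<in> G; a \<in> G; dist g a < d;
      \<And>Z. Z \<in> ?L \<Longrightarrow> \<exists>e>0. \<forall>t. \<bar>t\<bar> < e \<longrightarrow> dist g a \<le> dist g (a ** matrix_exp (t *\<^sub>R Z))\<rbrakk> \<Longrightarrow> g = a"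
    using critical_distance by blast
  have local: "h \<in> matrix_exp ` ?L" if h: "h \<in> G" "norm (h - mat 1) < min d (m / 2)" for h
  proof -
    \<comment> \<open>Compactness of the ball provides a nearest point, and the radius
      \<open>r\<close> keeps it inside: boundary points are sent at least \<open>m\<close> away from
      the identity, but a nearest image is within twice \<open>norm (h - mat 1) < m / 2\<close> of
      it.\<close>
    let ?B = "cball 0 r \<inter> ?L"
    have "compact ?B"
      by (intro compact_Int_closed compact_cball closed_lie)
    moreover have "continuous_on ?B (\<lambda>X. dist h (matrix_exp X))"
      by (intro continuous_intros cont) auto
    moreover have 0: "0 \<in> ?B" using r(1) lie_zero by auto
    ultimately obtain X0 where X0: "X0 \<in> ?B"
      and min: "\<And>X. X \<in> ?B \<Longrightarrow> dist h (matrix_exp X0) \<le> dist h (matrix_exp X)"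
      using continuous_attains_inf[of ?B "\<lambda>X. dist h (matrix_exp X)"] by blast
    have le: "dist h (matrix_exp X0) \<le> norm (h - mat 1)"
      using min[OF 0] by (simp add: dist_norm)
    have "norm X0 \<noteq> r"
    proof
      assume "norm X0 = r"
      then have "m \<le> norm (matrix_exp X0 - mat 1)" using m(2) X0 by auto
      also have "\<dots> \<le> norm (h - mat 1) + norm (h - matrix_exp X0)"
        using norm_triangle_ineq4[of "h - mat 1" "h - matrix_exp X0"] by simp
      finally show False using le h(2) by (simp add: dist_norm)
    qed
    then have X0r: "norm X0 < r" and X0L: "X0 \<in> ?L" using X0 by auto
    have "h = matrix_exp X0"
    proof (rule d(2)[OF h(1) exp_in[OF X0L]])
      show "dist h (matrix_exp X0) < d" using le h(2) by simp
      fix Z assume Z: "Z \<in> ?L"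
      \<comment> \<open>For such \<open>t\<close> the point \<open>X0 + t *\<^sub>R Z\<close> stays
        in the ball; adding 1 covers \<open>Z = 0\<close>.\<close>
      define e where "e = (r - norm X0) / (norm Z + 1)"
      have "norm Z + 1 > 0" by (simp add: add_nonneg_pos)
      then have e: "e > 0" using X0r by (simp add: e_def)
      have "dist h (matrix_exp X0) \<le> dist h (matrix_exp X0 ** matrix_exp (t *\<^sub>R Z))" if t: "\<bar>t\<bar> < e" for t
      proof -
        have "norm (X0 + t *\<^sub>R Z) \<le> norm X0 + \<bar>t\<bar> * norm Z"
          by (rule order_trans[OF norm_triangle_ineq]) simp
        also have "\<dots> \<le> norm X0 + e * (norm Z + 1)"
          using t e by (intro add_left_mono mult_mono) auto
        also have "\<dots> = r" using \<open>norm Z + 1 > 0\<close> by (simp add: e_def)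
        finally have "X0 + t *\<^sub>R Z \<in> ?B"
          using lie_add[OF X0L lie_scaleR[OF Z]] by simp
        from min[OF this] show ?thesis by (simp add: exp_add X0L lie_scaleR Z)
      qed
      then show "\<exists>e>0. \<forall>t. \<bar>t\<bar> < e \<longrightarrow> dist h (matrix_exp X0) \<le> dist h (matrix_exp X0 ** matrix_exp (t *\<^sub>R Z))"
        using e by blast
    qed
    then show ?thesis using X0L by blast
  qed
  \<comment> \<open>Density brings \<open>g\<close> close to some exponential, and dividing by it
    leads back to the case near the identity.\<close>
  have "closure (matrix_exp ` ?L) = G"
    using lie_zero exp_in by (intro closure_exp_invariant_eq[OF conn]) (auto simp: exp_add[symmetric] lie_add)
  then have "g \<in> closure (matrix_exp ` ?L)" using g by simp
  then obtain Y where Y: "Y \<in> ?L" and gY: "dist (matrix_exp Y) g < min d (m / 2)"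
    using d(1) m(1) unfolding closure_approachable by (metis half_gt_zero imageE min_less_iff_conj)
  let ?k = "adjoint_matrix (matrix_exp Y) ** g"
  have "?k - mat 1 = adjoint_matrix (matrix_exp Y) ** (g - matrix_exp Y)"
    by (simp add: matrix_mult.diff_right adjoint_mult_self exp_in Y)
  then have "norm (?k - mat 1) < min d (m / 2)"
    using gY by (simp add: norm_unitary_left unitary adjoint_in exp_in Y dist_norm norm_minus_commute)
  then obtain X where X: "X \<in> ?L" "?k = matrix_exp X"
    using local[of ?k] by (auto simp: mult_in adjoint_in exp_in Y g)
  have "matrix_exp (Y + X) = matrix_exp Y ** ?k"
    using X Y by (simp add: exp_add)
  also have "\<dots> = g"
    by (simp add: matrix_mul_assoc mult_adjoint_self exp_in Y)
  finally show thesis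
    using that lie_add[OF Y X(1)] by blast
qed

section \<open>Conjugation into a maximal torus\<close>

text \<open>Along the one-parameter group of the bracket \<open>?Z\<close> of \<open>X\<close> and
  \<open>H\<close>, the derivative of the inner product at 0 is \<open>inner ?Z ?Z\<close>, and it
  vanishes at a maximum.\<close>

lemma orbit_maximum_commutes:
  assumes X: "X \<in> lie_algebra G" and H: "H \<in> lie_algebra G"
    and max: "\<And>g. g \<in> G \<Longrightarrow> inner H (g ** X ** adjoint_matrix g) \<le> inner H X"
  shows "X ** H = H ** X"
proof -
  let ?Z = "X ** H - H ** X"
  let ?f = "\<lambda>t. inner H (matrix_exp (t *\<^sub>R ?Z) ** (X ** matrix_exp (t *\<^sub>R (- ?Z))))"
  have Z: "?Z \<in> lie_algebra G" by (rule lie_bracket[OF X H])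
  have "(?f has_vector_derivative inner H (matrix_exp (0 *\<^sub>R ?Z) ** (X ** (matrix_exp (0 *\<^sub>R (- ?Z)) ** - ?Z))
      + (matrix_exp (0 *\<^sub>R ?Z) ** ?Z) ** (X ** matrix_exp (0 *\<^sub>R (- ?Z))))) (at 0)"
    by (intro bounded_linear.has_vector_derivative[OF bounded_linear_inner_right]
        matrix_mult.has_vector_derivative matrix_exp_has_vector_derivative
        bounded_linear.has_vector_derivative[OF matrix_mult.bounded_linear_right])
  then have "DERIV ?f 0 :> inner H (?Z ** X - X ** ?Z)"
    unfolding has_real_derivative_iff_has_vector_derivative
    by (simp only: scaleR_zero_left matrix_exp_0 matrix_mul_lid matrix_mul_rid matrix_mult.minus_right
        uminus_add_conv_diff)
  then have "inner H (?Z ** X - X ** ?Z) = 0"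
  proof (rule DERIV_local_max[where d = 1])
    show "\<forall>t. \<bar>0 - t\<bar> < 1 \<longrightarrow> ?f t \<le> ?f 0"
    proof (intro allI impI)
      fix t :: real
      have "matrix_exp (t *\<^sub>R (- ?Z)) = adjoint_matrix (matrix_exp (t *\<^sub>R ?Z))"
        using matrix_exp_minus_adjoint[OF unitary[OF exp_scaleR_in[OF Z]], of t]
        by (simp only: scaleR_minus_right)
      then show "?f t \<le> ?f 0"
        using max[OF exp_scaleR_in[OF Z], of t] by (simp add: matrix_mul_assoc)
    qed
  qed simp
  moreover have "inner H (?Z ** X) = - inner ?Z (H ** X)"
    by (simp only: inner_commute[of H] inner_mult_right lie_skew[OF X] matrix_mult.minus_right inner_minus_right)
  moreover have "inner H (X ** ?Z) = - inner ?Z (X ** H)"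
    by (simp only: inner_commute[of H] inner_mult_left lie_skew[OF X] matrix_mult.minus_left inner_minus_right)
  ultimately have "inner ?Z ?Z = 0"
    by (simp add: inner_diff_right)
  then show ?thesis by simp
qed

lemma compact_lie_group_subgroup:
  assumes "K \<subseteq> G" "closed K" "mat 1 \<in> K"
    and "\<And>g. g \<in> K \<Longrightarrow> adjoint_matrix g \<in> K" "\<And>g h. g \<in> K \<Longrightarrow> h \<in> K \<Longrightarrow> g ** h \<in> K"
  shows "compact_lie_group K"
proof -
  have "unitary_matrix g" if "g \<in> K" for g
    using that assms(1) unitary by blast
  moreover have "compact K"
    using compact_Int_closed[OF compact_G assms(2)] assms(1) by (simp add: Int_absorb1)
  moreover have "invertible g \<and> matrix_inv g \<in> K" if "g \<in> K" for g
    using that calculation(1)[OF that] assms(4)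
    by (auto simp: matrix_inv_unitary unitary_matrix_def invertible_def)
  ultimately show ?thesis
    using assms(3,5) by (auto simp: compact_lie_group_def matrix_subgroup_def)
qed

lemma commute_adjoint:
  assumes g: "g \<in> G" and "g ** H = H ** g"
  shows "adjoint_matrix g ** H = H ** adjoint_matrix g"
proof -
  have "adjoint_matrix g ** H = adjoint_matrix g ** (H ** g) ** adjoint_matrix g"
    by (simp add: matrix_mul_assoc[symmetric] mult_adjoint_self[OF g])
  also have "\<dots> = (adjoint_matrix g ** g) ** H ** adjoint_matrix g"
    by (simp only: assms(2)[symmetric] matrix_mul_assoc)
  finally show ?thesis by (simp add: adjoint_mult_self[OF g])
qed

end

text \<open>After the conjugation for \<open>H\<close>, the next ones are taken in the centraliser
  of \<open>H\<close>, so the commutation already gained is kept. The rest of \<open>S\<close>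
  commutes with \<open>H\<close> and thus lies in the Lie algebra of this smaller group.\<close>

lemma conj_commutes_finite:
  fixes S :: "(complex^'n^'n) set"
  assumes "finite S" "compact_lie_group G" "S \<subseteq> lie_algebra G"
    and "\<And>A B. A \<in> S \<Longrightarrow> B \<in> S \<Longrightarrow> A ** B = B ** A" and "X \<in> lie_algebra G"
  shows "\<exists>g\<in>G. \<forall>A\<in>S. (g ** X ** adjoint_matrix g) ** A = A ** (g ** X ** adjoint_matrix g)"
  using assms
proof (induction S arbitrary: G X)
  case empty
  then interpret compact_unitary_group G by unfold_locales
  show ?case using one_in by blast
next
  case (insert H S)
  interpret compact_unitary_group G by unfold_locales (rule insert.prems)
  have H: "H \<in> lie_algebra G" using insert.prems by simp
  note X = \<open>X \<in> lie_algebra G\<close>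
  have "continuous_on G (\<lambda>g. inner H (g ** X ** adjoint_matrix g))"
    by (intro continuous_intros matrix_mult.continuous_on
        bounded_linear.continuous_on[OF bounded_linear_adjoint])
  then obtain g0 where g0: "g0 \<in> G"
    and max: "\<And>g. g \<in> G \<Longrightarrow> inner H (g ** X ** adjoint_matrix g) \<le> inner H (g0 ** X ** adjoint_matrix g0)"
    using continuous_attains_sup[OF compact_G, of "\<lambda>g. inner H (g ** X ** adjoint_matrix g)"] one_in
    by blast
  define X' where "X' = g0 ** X ** adjoint_matrix g0"
  have X': "X' \<in> lie_algebra G" unfolding X'_def by (intro lie_conj g0 X)
  have conj2: "(g ** g0) ** X ** adjoint_matrix (g ** g0) = g ** X' ** adjoint_matrix g" for g
    by (simp add: X'_def adjoint_mult matrix_mul_assoc)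
  have "X' ** H = H ** X'"
  proof (rule orbit_maximum_commutes[OF X' H])
    show "inner H (g ** X' ** adjoint_matrix g) \<le> inner H X'" if "g \<in> G" for g
      using max[OF mult_in[OF that g0]] unfolding conj2 X'_def .
  qed
  define G' where "G' = {g \<in> G. g ** H = H ** g}"
  have "compact_lie_group G'"
  proof (rule compact_lie_group_subgroup)
    have "closed {g. g ** H = H ** g}"
      by (intro closed_Collect_eq matrix_mult.continuous_on continuous_intros)
    then show "closed G'"
      using closed_Int[OF closed_G] by (simp add: G'_def Collect_conj_eq)
    show "g ** h \<in> G'" if "g \<in> G'" "h \<in> G'" for g h
    proof -
      have *: "g ** H = H ** g" "h ** H = H ** h" using that by (auto simp: G'_def)
      have "g ** h ** H = g ** H ** h" by (simp only: *(2) matrix_mul_assoc[symmetric])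
      also have "\<dots> = H ** (g ** h)" by (simp only: *(1) matrix_mul_assoc)
      finally show ?thesis using that by (simp add: G'_def mult_in)
    qed
  qed (auto simp: G'_def one_in adjoint_in commute_adjoint)
  moreover have lie': "Y \<in> lie_algebra G'" if "Y \<in> lie_algebra G" "H ** Y = Y ** H" for Y
    unfolding lie_algebra_def G'_def
    using exp_commute_of_commute[OF that(2)] exp_scaleR_in[OF that(1)] by simp
  moreover have "S \<subseteq> lie_algebra G'"
    using insert.prems by (auto intro!: lie')
  moreover have "X' \<in> lie_algebra G'"
    by (intro lie' X') (simp add: \<open>X' ** H = H ** X'\<close>)
  ultimately obtain g1 where g1: "g1 \<in> G'"
    and S: "\<And>A. A \<in> S \<Longrightarrow> (g1 ** X' ** adjoint_matrix g1) ** A = A ** (g1 ** X' ** adjoint_matrix g1)"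
    using insert.IH[of G' X'] insert.prems(3) by (metis insertCI)
  have g1G: "g1 \<in> G" and g1H: "g1 ** H = H ** g1" using g1 by (auto simp: G'_def)
  have "(g1 ** X' ** adjoint_matrix g1) ** H = g1 ** X' ** (adjoint_matrix g1 ** H)"
    by (simp only: matrix_mul_assoc)
  also have "\<dots> = g1 ** (X' ** H) ** adjoint_matrix g1"
    by (simp only: commute_adjoint[OF g1G g1H] matrix_mul_assoc)
  also have "\<dots> = (g1 ** H) ** X' ** adjoint_matrix g1"
    by (simp only: \<open>X' ** H = H ** X'\<close> matrix_mul_assoc)
  also have "\<dots> = H ** (g1 ** X' ** adjoint_matrix g1)"
    by (simp only: g1H matrix_mul_assoc)
  finally have "(g1 ** X' ** adjoint_matrix g1) ** H = H ** (g1 ** X' ** adjoint_matrix g1)" .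
  then show ?case
    using S mult_in[OF g1G g0] conj2[of g1] by (intro bexI[of _ "g1 ** g0"]) auto
qed

context compact_unitary_group
begin

lemma conj_exp_in_maximal_torus:
  assumes T: "maximal_torus G T" and X: "X \<in> lie_algebra G"
  shows "\<exists>g\<in>G. g ** matrix_exp X ** adjoint_matrix g \<in> T"
proof -
  have tor: "torus_group T" and TG: "T \<subseteq> G"
    and mx: "\<And>T'. torus_group T' \<Longrightarrow> T' \<subseteq> G \<Longrightarrow> T \<subseteq> T' \<Longrightarrow> T' = T"
    using T by (auto simp: maximal_torus_def)
  interpret T: compact_unitary_group T
    using tor by unfold_locales (simp add: torus_group_def)
  have Tconn: "connected T" and Tcomm: "\<And>g h. g \<in> T \<Longrightarrow> h \<in> T \<Longrightarrow> g ** h = h ** g"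
    using tor by (auto simp: torus_group_def)
  \<comment> \<open>Commutation is linear, so a finite basis suffices and the finite induction
    applies.\<close>
  obtain B where B: "B \<subseteq> lie_algebra T" "independent B" "lie_algebra T \<subseteq> span B"
    using maximal_independent_subset by blast
  have "finite B" using B(2) by (rule finiteI_independent)
  moreover have "B \<subseteq> lie_algebra G" using B(1) TG by (auto simp: lie_algebra_def)
  moreover have "A ** A' = A' ** A" if "A \<in> B" "A' \<in> B" for A A'
    using T.lie_commute[OF Tcomm] that B(1) by blast
  ultimately obtain g where g: "g \<in> G"
    and gB: "\<And>A. A \<in> B \<Longrightarrow> (g ** X ** adjoint_matrix g) ** A = A ** (g ** X ** adjoint_matrix g)"
    using conj_commutes_finite[OF _ compact_lie_group _ _ X, of B] by metis
  define Y where "Y = g ** X ** adjoint_matrix g"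
  have Y: "Y \<in> lie_algebra G" unfolding Y_def by (intro lie_conj g X)
  have "A ** Y = Y ** A" if "A \<in> span B" for A
    using that
  proof (induction rule: span_induct)
    case base
    show ?case
      by (auto simp: subspace_def matrix_mult.add_left matrix_mult.add_right matrix_mult.scaleR_left
          matrix_mult.scaleR_right)
  next
    case (step A)
    then show ?case using gB[OF step] by (simp add: Y_def)
  qed
  \<comment> \<open>Commuting with the Lie algebra of \<open>T\<close> gives commuting with
    \<open>T\<close> because exp maps onto \<open>T\<close>.\<close>
  then have comm: "t ** matrix_exp (s *\<^sub>R Y) = matrix_exp (s *\<^sub>R Y) ** t" if "t \<in> T" for s t
  proof -
    obtain A where A: "A \<in> lie_algebra T" "matrix_exp A = t"
      using T.exp_surj_abelian[OF Tconn Tcomm \<open>t \<in> T\<close>] by blast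
    then have "Y ** A = A ** Y" using \<open>\<And>A. A \<in> span B \<Longrightarrow> A ** Y = Y ** A\<close> B(3) by auto
    then have "Y ** t = t ** Y" using exp_commute_of_commute[of Y A 1] A(2) by simp
    then show ?thesis by (intro exp_commute_of_commute) simp
  qed
  \<comment> \<open>The group generated by \<open>T\<close> and the one-parameter group of
    \<open>Y\<close>. The latter may wind densely, so \<open>K\<close> need not be closed; its
    closure is a torus containing \<open>T\<close>, and maximality applies.\<close>
  define K where "K = (\<lambda>(t, s). t ** matrix_exp (s *\<^sub>R Y)) ` (T \<times> UNIV)"
  have Kmem: "t ** matrix_exp (s *\<^sub>R Y) \<in> K" if "t \<in> T" for t s
    using that by (auto simp: K_def)
  have prod: "(t ** matrix_exp (s *\<^sub>R Y)) ** (t' ** matrix_exp (s' *\<^sub>R Y))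
      = (t ** t') ** matrix_exp ((s + s') *\<^sub>R Y)" if "t \<in> T" "t' \<in> T" for t t' s s'
  proof -
    have "(t ** matrix_exp (s *\<^sub>R Y)) ** (t' ** matrix_exp (s' *\<^sub>R Y))
        = t ** (matrix_exp (s *\<^sub>R Y) ** t') ** matrix_exp (s' *\<^sub>R Y)"
      by (simp only: matrix_mul_assoc)
    also have "\<dots> = (t ** t') ** (matrix_exp (s *\<^sub>R Y) ** matrix_exp (s' *\<^sub>R Y))"
      by (simp only: comm[OF that(2), symmetric] matrix_mul_assoc)
    finally show ?thesis by (simp only: matrix_exp_scaleR_add)
  qed
  have KG: "K \<subseteq> G"
    using TG by (auto simp: K_def intro!: mult_in exp_scaleR_in Y)
  have Kmult: "a ** b \<in> K" if "a \<in> K" "b \<in> K" for a b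
    using that by (auto simp: K_def prod intro!: Kmem[unfolded K_def] T.mult_in)
  have Kcomm: "a ** b = b ** a" if "a \<in> K" "b \<in> K" for a b
    using that by (auto simp: K_def prod Tcomm add.commute)
  have Kadj: "adjoint_matrix a \<in> K" if aK: "a \<in> K" for a
  proof -
    obtain t s where t: "t \<in> T" "a = t ** matrix_exp (s *\<^sub>R Y)"
      using aK unfolding K_def by (auto simp del: scaleR_minus_left)
    have "matrix_exp ((- s) *\<^sub>R Y) = adjoint_matrix (matrix_exp (s *\<^sub>R Y))"
      using matrix_exp_minus_adjoint[OF unitary[OF exp_scaleR_in[OF Y]], of s] by simp
    then have "adjoint_matrix a = adjoint_matrix t ** matrix_exp ((- s) *\<^sub>R Y)"
      unfolding comm[OF T.adjoint_in[OF t(1)]] by (simp only: t(2) adjoint_mult)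
    then show ?thesis using Kmem[OF T.adjoint_in[OF t(1)], of "- s"] by simp
  qed
  have TK: "T \<subseteq> K"
  proof
    fix t assume "t \<in> T"
    then show "t \<in> K" using Kmem[of t 0] by simp
  qed
  have seq: "\<exists>f. (\<forall>m. f m \<in> K) \<and> f \<longlonglongrightarrow> a" if "a \<in> closure K" for a
    using that by (simp add: closure_sequential)
  have "torus_group (closure K)"
    unfolding torus_group_def
  proof (intro conjI ballI)
    show "compact_lie_group (closure K)"
    proof (rule compact_lie_group_subgroup)
      show "closure K \<subseteq> G" using KG closed_G by (rule closure_minimal)
      show "mat 1 \<in> closure K" using TK T.one_in closure_subset by blast
      show "adjoint_matrix a \<in> closure K" if a: "a \<in> closure K" for a
      proof -
        obtain f where f: "\<And>m. f m \<in> K" "f \<longlonglongrightarrow> a" using seq[OF a] by blast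
        then have "(\<lambda>m. adjoint_matrix (f m)) \<longlonglongrightarrow> adjoint_matrix a" by (intro tendsto_adjoint)
        then show ?thesis
          unfolding closure_sequential using Kadj[OF f(1)]
          by (intro exI[of _ "\<lambda>m. adjoint_matrix (f m)"]) simp
      qed
      show "a ** b \<in> closure K" if a: "a \<in> closure K" and b: "b \<in> closure K" for a b
      proof -
        obtain f h where f: "\<And>m. f m \<in> K" "f \<longlonglongrightarrow> a" and h: "\<And>m. h m \<in> K" "h \<longlonglongrightarrow> b"
          using seq[OF a] seq[OF b] by blast
        then have "(\<lambda>m. f m ** h m) \<longlonglongrightarrow> a ** b" by (intro matrix_mult.tendsto)
        then show ?thesis
          unfolding closure_sequential using Kmult[OF f(1) h(1)]
          by (intro exI[of _ "\<lambda>m. f m ** h m"]) simp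
      qed
    qed simp
    have "continuous_on (T \<times> UNIV) (\<lambda>(t, s). t ** matrix_exp (s *\<^sub>R Y))"
      unfolding case_prod_unfold
      by (intro matrix_mult.continuous_on continuous_intros
          continuous_on_compose2[OF continuous_matrix_exp_scaleR[of UNIV]]) auto
    then have "connected K"
      unfolding K_def by (intro connected_continuous_image connected_Times Tconn connected_UNIV)
    then show "connected (closure K)" by (rule connected_imp_connected_closure)
    show "a ** b = b ** a" if a: "a \<in> closure K" and b: "b \<in> closure K" for a b
    proof -
      obtain f h where f: "\<And>m. f m \<in> K" "f \<longlonglongrightarrow> a" and h: "\<And>m. h m \<in> K" "h \<longlonglongrightarrow> b"
        using seq[OF a] seq[OF b] by blast
      have "(\<lambda>m. f m ** h m) \<longlonglongrightarrow> a ** b" "(\<lambda>m. h m ** f m) \<longlonglongrightarrow> b ** a"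
        by (intro matrix_mult.tendsto f h)+
      then show ?thesis using Kcomm[OF f(1) h(1)] LIMSEQ_unique by auto
    qed
  qed
  then have "closure K = T"
    using TK closure_subset[of K] closure_minimal[OF KG closed_G] by (intro mx) auto
  moreover have "matrix_exp Y \<in> K"
    using Kmem[OF T.one_in, of 1] by simp
  ultimately have "matrix_exp Y \<in> T" using closure_subset by blast
  then show ?thesis using g by (auto simp: Y_def conj_exp)
qed

text \<open>Only a dense set of elements is known to consist of exponentials; compactness of
  \<open>G\<close> makes the conjugating elements converge along a subsequence.\<close>

theorem conj_in_maximal_torus:
  assumes conn: "connected G" and T: "maximal_torus G T" and h: "h \<in> G"
  obtains g where "g \<in> G" "g ** h ** adjoint_matrix g \<in> T"
proof -
  have "h \<in> closure exp_products" using closure_exp_products[OF conn] h by simp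
  then obtain f where f: "\<And>m. f m \<in> exp_products" "f \<longlonglongrightarrow> h"
    by (auto simp: closure_sequential)
  have "\<exists>g. g \<in> G \<and> g ** f m ** adjoint_matrix g \<in> T" for m
  proof -
    obtain Y where "Y \<in> lie_algebra G" "f m = matrix_exp Y"
      using exp_products_exp[OF f(1)[of m]] by blast
    then show ?thesis using conj_exp_in_maximal_torus[OF T, of Y] by auto
  qed
  then have "\<forall>m. \<exists>g. g \<in> G \<and> g ** f m ** adjoint_matrix g \<in> T" by blast
  from choice[OF this] obtain g where g: "\<And>m. g m \<in> G" "\<And>m. g m ** f m ** adjoint_matrix (g m) \<in> T"
    by blast
  obtain a r where a: "a \<in> G" and r: "strict_mono r" and ga: "(g \<circ> r) \<longlonglongrightarrow> a"
    using compact_G g(1) unfolding compact_def by metis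
  have "a ** h ** adjoint_matrix a \<in> T"
  proof (rule closed_sequentially)
    show "closed T"
      using T by (simp add: maximal_torus_def torus_group_def compact_lie_group_def compact_imp_closed)
    show "g (r m) ** f (r m) ** adjoint_matrix (g (r m)) \<in> T" for m
      by (rule g(2))
    show "(\<lambda>m. g (r m) ** f (r m) ** adjoint_matrix (g (r m))) \<longlonglongrightarrow> a ** h ** adjoint_matrix a"
      using ga LIMSEQ_subseq_LIMSEQ[OF f(2) r]
      by (intro matrix_mult.tendsto tendsto_adjoint) (simp_all add: o_def)
  qed
  then show thesis using that a by blast
qed

end

section \<open>Summability of Sobolev weights of negative order\<close>

lemma sum_inverse_one_plus_square_int_bounded:
  obtains B where "\<And>J. finite J \<Longrightarrow> (\<Sum>j\<in>J. 1 / (1 + (real_of_int j)\<^sup>2)) \<le> B"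
proof -
  let ?a = "\<lambda>j::int. 1 / (1 + (real_of_int j)\<^sup>2)"
  let ?b = "\<lambda>n::nat. 1 / (1 + (real n)\<^sup>2)"
  have b: "summable ?b"
  proof (rule summable_comparison_test')
    show "summable (\<lambda>n. inverse (real n ^ 2))" by (rule inverse_power_summable) simp
    show "norm (?b n) \<le> inverse (real n ^ 2)" if "n \<ge> 1" for n
      using that le_imp_inverse_le[of "(real n)\<^sup>2" "1 + (real n)\<^sup>2"] by (simp add: inverse_eq_divide)
  qed
  \<comment> \<open>One estimate for both halves of the integers, with \<open>h\<close> the absolute
    value on each.\<close>
  have pos: "sum ?a J \<le> suminf ?b" if J: "finite J" and h: "inj_on h J" "\<And>j. j \<in> J \<Longrightarrow> (real (h j))\<^sup>2 = (real_of_int j)\<^sup>2"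
    for J and h :: "int \<Rightarrow> nat"
  proof -
    have "sum ?a J = sum ?b (h ` J)"
      using h by (simp add: sum.reindex)
    also have "\<dots> \<le> suminf ?b"
      using J by (intro sum_le_suminf b) auto
    finally show ?thesis .
  qed
  have "sum ?a J \<le> suminf ?b + suminf ?b" if J: "finite J" for J
  proof -
    have "sum ?a J = sum ?a (J \<inter> {0..}) + sum ?a (J \<inter> {..<0})"
      using J by (subst sum.union_disjoint[symmetric]) (auto intro!: sum.cong)
    moreover have "sum ?a (J \<inter> {0..}) \<le> suminf ?b"
      using J by (intro pos[of _ nat]) (auto simp: inj_on_def)
    moreover have "sum ?a (J \<inter> {..<0}) \<le> suminf ?b"
      using J by (intro pos[of _ "\<lambda>j. nat (- j)"]) (auto simp: inj_on_def)
    ultimately show ?thesis by linarith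
  qed
  then show thesis by (rule that)
qed

text \<open>Each of the d factors is at most \<open>1 + (norm (lattice_vec k))\<^sup>2\<close>, and
  the weight of order -d is the inverse of the d-th power of this number. Summation over the lattice
  thus splits into d sums over the integers.\<close>

lemma sobolev_weight_le_prod:
  "sobolev_weight (- real CARD('d)) (k :: int^'d) \<le> (\<Prod>i\<in>UNIV. 1 / (1 + (real_of_int (k $ i))\<^sup>2))"
proof -
  let ?n = "1 + (norm (lattice_vec k))\<^sup>2"
  have n: "?n > 0" by (simp add: add_pos_nonneg)
  have le: "1 + (real_of_int (k $ i))\<^sup>2 \<le> ?n" for i
  proof -
    have "\<bar>lattice_vec k $ i\<bar> \<le> norm (lattice_vec k)" by (rule component_le_norm_cart)
    then have "\<bar>lattice_vec k $ i\<bar>\<^sup>2 \<le> (norm (lattice_vec k))\<^sup>2" by (rule power_mono) simp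
    then show ?thesis by (simp add: lattice_vec_def)
  qed
  have p: "(\<Prod>i\<in>(UNIV::'d set). 1 + (real_of_int (k $ i))\<^sup>2) > 0"
    by (intro prod_pos) (simp add: add_pos_nonneg)
  have "(\<Prod>i\<in>(UNIV::'d set). 1 + (real_of_int (k $ i))\<^sup>2) \<le> (\<Prod>i\<in>(UNIV::'d set). ?n)"
    using le by (intro prod_mono) simp
  then have "(\<Prod>i\<in>(UNIV::'d set). 1 + (real_of_int (k $ i))\<^sup>2) \<le> ?n ^ CARD('d)"
    by simp
  then have "inverse (?n ^ CARD('d)) \<le> inverse (\<Prod>i\<in>(UNIV::'d set). 1 + (real_of_int (k $ i))\<^sup>2)"
    using p by (rule le_imp_inverse_le)
  moreover have "sobolev_weight (- real CARD('d)) k = inverse (?n ^ CARD('d))"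
    using n by (simp add: sobolev_weight_def powr_minus powr_realpow)
  ultimately show ?thesis
    by (simp add: prod_inversef[unfolded comp_def] divide_inverse)
qed

lemma sobolev_weight_nonneg: "sobolev_weight s k \<ge> 0"
  by (simp add: sobolev_weight_def)

lemma summable_sobolev_weight:
  "(sobolev_weight (- real CARD('d)) :: int^'d \<Rightarrow> real) summable_on UNIV"
proof -
  obtain B where B: "\<And>J. finite J \<Longrightarrow> (\<Sum>j\<in>J. 1 / (1 + (real_of_int j)\<^sup>2)) \<le> B"
    using sum_inverse_one_plus_square_int_bounded by blast
  have "sum (sobolev_weight (- real CARD('d))) F \<le> B ^ CARD('d)" if F: "finite F" for F :: "(int^'d) set"
  proof -
    \<comment> \<open>All coordinates that occur in \<open>F\<close>: the finite set
      \<open>F\<close> lies in a cube, over which the sum of products factorises.\<close>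
    define J where "J = (\<Union>k\<in>F. range (($) k))"
    have J: "finite J" unfolding J_def using F by simp
    let ?p = "\<lambda>k::int^'d. \<Prod>i\<in>UNIV. 1 / (1 + (real_of_int (k $ i))\<^sup>2)"
    have FJ: "F \<subseteq> vec_lambda ` PiE UNIV (\<lambda>_. J)"
    proof
      fix k assume "k \<in> F"
      then have "($) k \<in> PiE UNIV (\<lambda>_. J)" by (auto simp: J_def)
      then have "vec_lambda (($) k) \<in> vec_lambda ` PiE UNIV (\<lambda>_. J)" by (rule imageI)
      then show "k \<in> vec_lambda ` PiE UNIV (\<lambda>_. J)" by simp
    qed
    have "sum (sobolev_weight (- real CARD('d))) F \<le> sum ?p F"
      by (intro sum_mono sobolev_weight_le_prod)
    also have "\<dots> \<le> sum ?p (vec_lambda ` PiE UNIV (\<lambda>_. J))"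
      using FJ J by (intro sum_mono2 finite_imageI finite_PiE prod_nonneg) auto
    also have "\<dots> = (\<Sum>f\<in>PiE UNIV (\<lambda>_. J). \<Prod>i\<in>(UNIV::'d set). 1 / (1 + (real_of_int (f i))\<^sup>2))"
      by (subst sum.reindex) (auto simp: inj_on_def vec_lambda_inject)
    also have "\<dots> = (\<Prod>i\<in>(UNIV::'d set). \<Sum>j\<in>J. 1 / (1 + (real_of_int j)\<^sup>2))"
      using J by (subst prod_sum_PiE) auto
    also have "\<dots> \<le> (\<Prod>i\<in>(UNIV::'d set). B)"
      using B[OF J] by (intro prod_mono) (auto intro!: sum_nonneg)
    finally show ?thesis by simp
  qed
  then show ?thesis
    by (intro nonneg_bounded_partial_sums_imp_summable_on[where C = "B ^ CARD('d)"] sobolev_weight_nonneg)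
      (auto simp: eventually_finite_subsets_at_top)
qed

section \<open>Cluster points of bounded functionals\<close>

text \<open>The cluster point comes from compactness of an arbitrary product of discs. It is
  approximated on finitely many coordinates at a time, by arbitrarily late members of the
  sequence.\<close>

lemma bounded_functions_cluster:
  fixes v :: "nat \<Rightarrow> 'p \<Rightarrow> complex"
  assumes v: "\<And>m p. norm (v m p) \<le> b p"
  obtains u where "\<And>p. norm (u p) \<le> b p"
    "\<And>P e M. finite P \<Longrightarrow> e > 0 \<Longrightarrow> \<exists>m\<ge>M. \<forall>p\<in>P. norm (v m p - u p) < e"
proof -
  let ?F = "filtermap v sequentially"
  have "compact {f. \<forall>p. f p \<in> cball (0::complex) (b p)}"
    by (rule compact_functions) (rule compact_cball)
  moreover have "?F \<noteq> bot" by (simp add: filtermap_bot_iff)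
  moreover have "\<forall>\<^sub>F f in ?F. f \<in> {f. \<forall>p. f p \<in> cball 0 (b p)}"
    using v by (simp add: eventually_filtermap)
  ultimately obtain u where u: "\<And>p. norm (u p) \<le> b p" and cl: "inf (nhds u) ?F \<noteq> bot"
    unfolding compact_filter by auto
  have "\<exists>m\<ge>M. \<forall>p\<in>P. norm (v m p - u p) < e" if P: "finite P" and e: "e > 0" for P e M
  proof (rule ccontr)
    assume no: "\<not> ?thesis"
    let ?W = "{f. \<forall>p\<in>P. norm (f p - u p) < e}"
    have "?W = (\<Inter>p\<in>P. {f. norm (f p - u p) < e})" by auto
    moreover have "open (\<Inter>p\<in>P. {f. norm (f p - u p) < e})"
      by (intro open_INT P ballI open_Collect_less continuous_intros
          continuous_on_product_coordinates)
    ultimately have "open ?W" by simp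
    then have "\<forall>\<^sub>F f in nhds u. f \<in> ?W" using e by (intro eventually_nhds_in_open) auto
    moreover have "\<forall>\<^sub>F f in ?F. f \<notin> ?W"
      using no unfolding eventually_filtermap eventually_sequentially by auto
    ultimately have "\<forall>\<^sub>F f in inf (nhds u) ?F. False"
      unfolding eventually_inf by blast
    then show False using cl by (simp add: trivial_limit_def)
  qed
  then show thesis using that u by blast
qed

section \<open>Bounded functionals as distributions of order -d\<close>

lemma torus_smooth_continuous: "f \<in> torus_smooth \<Longrightarrow> continuous_on S f"
proof -
  assume "f \<in> torus_smooth"
  then have "partial_derivs [] f differentiable (at x)" for x
    unfolding torus_smooth_def by blast
  then show ?thesis
    by (simp add: differentiable_imp_continuous_within continuous_at_imp_continuous_on)
qed

lemma content_unit_cart: "measure lborel (cbox (0::real^'d) 1) = 1"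
proof -
  have "(0::real^'d) \<in> cbox 0 1" by (simp add: mem_box_cart)
  then show ?thesis by (subst content_cbox_cart) auto
qed

text \<open>The bound by the integral norm of the test function makes linearity sufficient for
  continuity.\<close>
lemma bounded_linear_functional_distribution:
  fixes u :: "'d::finite torus_functional"
  assumes lin: "\<And>f g c. continuous_on (cbox 0 1) f \<Longrightarrow> continuous_on (cbox 0 1) g \<Longrightarrow>
      u (\<lambda>x. c * f x + g x) = c * u f + u g"
    and bnd: "\<And>f. continuous_on (cbox 0 1) f \<Longrightarrow>
      norm (u f) \<le> C * integral (cbox 0 1) (\<lambda>x. norm (f x))"
    and C: "C \<ge> 0"
  shows "torus_distribution u"
  unfolding torus_distribution_def
proof (intro conjI ballI allI impI)
  fix f g :: "real^'d \<Rightarrow> complex" and c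
  assume "f \<in> torus_smooth" "g \<in> torus_smooth"
  then show "u (\<lambda>x. c * f x + g x) = c * u f + u g"
    by (intro lin torus_smooth_continuous)
next
  fix F f
  assume "smooth_converges F (f :: real^'d \<Rightarrow> complex)"
  then have Fs: "\<And>m. F m \<in> torus_smooth" and fs: "f \<in> torus_smooth"
    and ul: "uniform_limit UNIV F f sequentially"
    by (auto simp: smooth_converges_def dest: spec[of _ "[]"])
  have Fc: "continuous_on (cbox 0 1) (F m)" for m using Fs by (rule torus_smooth_continuous)
  have fc: "continuous_on (cbox 0 1) f" using fs by (rule torus_smooth_continuous)
  show "(\<lambda>m. u (F m)) \<longlonglongrightarrow> u f"
    unfolding LIMSEQ_def
  proof (intro allI impI)
    fix e :: real assume e: "e > 0"
    define e' where "e' = e / (C + 1)"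
    have e': "e' > 0" using e C by (simp add: e'_def)
    have Ce: "C * e' < e" using e C by (simp add: e'_def field_simps)
    obtain N where N: "\<And>m x. m \<ge> N \<Longrightarrow> dist (F m x) (f x) < e'"
      using uniform_limitD[OF ul e'] unfolding eventually_sequentially by auto
    have "dist (u (F m)) (u f) < e" if "m \<ge> N" for m
    proof -
      have "u (\<lambda>x. (- 1) * f x + F m x) = (- 1) * u f + u (F m)"
        by (intro lin fc Fc)
      then have "dist (u (F m)) (u f) = norm (u (\<lambda>x. F m x - f x))"
        by (simp add: dist_norm)
      also have "\<dots> \<le> C * integral (cbox 0 1) (\<lambda>x. norm (F m x - f x))"
        by (intro bnd continuous_intros Fc fc)
      also have "\<dots> \<le> C * integral (cbox (0::real^'d) 1) (\<lambda>x. e')"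
        using N[OF that] C
        by (intro mult_left_mono integral_le integrable_continuous continuous_intros Fc fc)
          (auto simp: dist_norm intro: less_imp_le)
      also have "\<dots> = C * e'" by (simp add: content_unit_cart)
      finally show ?thesis using Ce by simp
    qed
    then show "\<exists>N. \<forall>m\<ge>N. dist (u (F m)) (u f) < e" by blast
  qed
qed

lemma distribution_of_bound:
  fixes f :: "real^'d \<Rightarrow> complex"
  assumes f: "continuous_on (cbox 0 1) f" "\<And>x. norm (f x) \<le> C" and \<phi>: "continuous_on (cbox 0 1) \<phi>"
  shows "norm (distribution_of f \<phi>) \<le> C * integral (cbox 0 1) (\<lambda>x. norm (\<phi> x))"
proof -
  have "norm (distribution_of f \<phi>) \<le> integral (cbox 0 1) (\<lambda>x. C * norm (\<phi> x))"
    unfolding distribution_of_def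
    by (intro integral_norm_bound_integral integrable_continuous continuous_intros f \<phi>)
      (simp add: norm_mult mult_right_mono f)
  then show ?thesis by simp
qed

lemma distribution_of_linear:
  fixes f :: "real^'d \<Rightarrow> complex"
  assumes "continuous_on (cbox 0 1) f" "continuous_on (cbox 0 1) \<phi>" "continuous_on (cbox 0 1) \<psi>"
  shows "distribution_of f (\<lambda>x. c * \<phi> x + \<psi> x) = c * distribution_of f \<phi> + distribution_of f \<psi>"
proof -
  have "distribution_of f (\<lambda>x. c * \<phi> x + \<psi> x) = integral (cbox 0 1) (\<lambda>x. c * (f x * \<phi> x) + f x * \<psi> x)"
    unfolding distribution_of_def by (simp add: algebra_simps)
  also have "\<dots> = integral (cbox 0 1) (\<lambda>x. c * (f x * \<phi> x)) + integral (cbox 0 1) (\<lambda>x. f x * \<psi> x)"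
    by (intro integral_add integrable_continuous continuous_intros assms)
  finally show ?thesis by (simp add: distribution_of_def)
qed

lemma continuous_fourier_mode:
  "continuous_on S (\<lambda>x. cis (- 2 * pi * (x \<bullet> lattice_vec k)))"
  by (intro continuous_intros)

lemma fourier_coeff_bound:
  fixes u :: "'d::finite torus_functional"
  assumes "\<And>f. continuous_on (cbox 0 1) f \<Longrightarrow> norm (u f) \<le> C * integral (cbox 0 1) (\<lambda>x. norm (f x))"
  shows "norm (fourier_coeff u k) \<le> C"
  using assms[OF continuous_fourier_mode, of k] by (simp add: fourier_coeff_def content_unit_cart)

text \<open>Fourier modes have modulus 1, so all Fourier coefficients are bounded by
  \<open>C\<close>, and the weights are summable.\<close>

lemma bounded_functional_sobolev:
  fixes u :: "'d::finite torus_functional"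
  assumes lin: "\<And>f g c. continuous_on (cbox 0 1) f \<Longrightarrow> continuous_on (cbox 0 1) g \<Longrightarrow>
      u (\<lambda>x. c * f x + g x) = c * u f + u g"
    and bnd: "\<And>f. continuous_on (cbox 0 1) f \<Longrightarrow>
      norm (u f) \<le> C * integral (cbox 0 1) (\<lambda>x. norm (f x))"
    and C: "C \<ge> 0"
  shows "u \<in> sobolev (- real CARD('d))"
proof -
  have "(\<lambda>k. sobolev_weight (- real CARD('d)) (k :: int^'d) * (norm (fourier_coeff u k))\<^sup>2) summable_on UNIV"
  proof (rule summable_on_comparison_test)
    show "(\<lambda>k. sobolev_weight (- real CARD('d)) (k :: int^'d) * C\<^sup>2) summable_on UNIV"
      by (intro summable_on_cmult_left summable_sobolev_weight)
    show "sobolev_weight (- real CARD('d)) k * (norm (fourier_coeff u k))\<^sup>2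
        \<le> sobolev_weight (- real CARD('d)) k * C\<^sup>2" for k :: "int^'d"
      by (intro mult_left_mono power_mono sobolev_weight_nonneg fourier_coeff_bound bnd) auto
  qed (simp add: sobolev_weight_nonneg)
  moreover have "torus_distribution u"
    by (rule bounded_linear_functional_distribution[OF lin bnd C])
  ultimately show ?thesis
    unfolding sobolev_def by blast
qed

text \<open>Dominated convergence in quantitative form: \<open>K\<close> and \<open>\<delta>\<close>
  depend only on \<open>e\<close> and \<open>C\<close>, so they can be fixed before a member of the
  sequence is chosen.\<close>

lemma sobolev_dist_small:
  assumes e: "e > 0" and C: "C \<ge> 0"
  obtains K :: "(int^'d) set" and \<delta> where "finite K" "\<delta> > 0"
    "\<And>u v :: 'd::finite torus_functional. \<lbrakk>\<And>k. norm (fourier_coeff u k) \<le> C;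
      \<And>k. norm (fourier_coeff v k) \<le> C;
      \<And>k. k \<in> K \<Longrightarrow> norm (fourier_coeff u k - fourier_coeff v k) < \<delta>\<rbrakk>
      \<Longrightarrow> sobolev_dist (- real CARD('d)) u v < e"
proof -
  let ?w = "sobolev_weight (- real CARD('d)) :: int^'d \<Rightarrow> real"
  have w: "?w summable_on A" for A
    using summable_sobolev_weight by (rule summable_on_subset_banach) simp
  \<comment> \<open>Coefficients differ by at most \<open>2 * C\<close>, so a tail of mass
    \<open>\<epsilon>\<close> contributes at most a quarter of the square of \<open>e\<close>;
    \<open>\<delta>\<close> is chosen for the same share on \<open>K\<close>. The summands 1 avoid
    division by zero.\<close>
  define \<epsilon> where "\<epsilon> = e\<^sup>2 / (4 * (4 * C\<^sup>2 + 1))"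
  have \<epsilon>: "\<epsilon> > 0" using e by (simp add: \<epsilon>_def add_nonneg_pos)
  have \<epsilon>C: "4 * C\<^sup>2 * \<epsilon> \<le> e\<^sup>2 / 4"
  proof -
    have "4 * C\<^sup>2 * \<epsilon> \<le> (4 * C\<^sup>2 + 1) * \<epsilon>" using \<epsilon> by (intro mult_right_mono) auto
    also have "\<dots> = e\<^sup>2 / 4"
      using add_nonneg_pos[of "4 * C\<^sup>2" 1] by (simp add: \<epsilon>_def field_simps)
    finally show ?thesis .
  qed
  obtain K where K: "finite K" "dist (sum ?w K) (infsum ?w UNIV) \<le> \<epsilon>"
    using infsum_finite_approximation[OF w \<epsilon>] by blast
  have "infsum ?w (K \<union> - K) = infsum ?w K + infsum ?w (- K)"
    by (intro infsum_Un_disjoint w) auto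
  then have tail: "infsum ?w (- K) \<le> \<epsilon>"
    using K by (simp add: dist_real_def)
  have sK: "sum ?w K \<ge> 0" by (intro sum_nonneg sobolev_weight_nonneg)
  define \<delta> where "\<delta> = sqrt (e\<^sup>2 / (4 * (sum ?w K + 1)))"
  have \<delta>: "\<delta> > 0" using e sK by (simp add: \<delta>_def)
  have \<delta>K: "sum ?w K * \<delta>\<^sup>2 \<le> e\<^sup>2 / 4"
  proof -
    have "\<delta>\<^sup>2 = e\<^sup>2 / (4 * (sum ?w K + 1))" using sK by (simp add: \<delta>_def)
    then have "(sum ?w K + 1) * \<delta>\<^sup>2 = e\<^sup>2 / 4" using sK by (simp add: field_simps)
    then show ?thesis by (simp add: distrib_right) (smt (verit) zero_le_power2)
  qed
  have "sobolev_dist (- real CARD('d)) u v < e"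
    if u: "\<And>k. norm (fourier_coeff u k) \<le> C" and v: "\<And>k. norm (fourier_coeff v k) \<le> C"
      and uv: "\<And>k. k \<in> K \<Longrightarrow> norm (fourier_coeff u k - fourier_coeff v k) < \<delta>"
    for u v :: "'d torus_functional"
  proof -
    let ?t = "\<lambda>k. ?w k * (norm (fourier_coeff u k - fourier_coeff v k))\<^sup>2"
    have le: "?t k \<le> ?w k * (4 * C\<^sup>2)" for k
    proof -
      have "norm (fourier_coeff u k - fourier_coeff v k) \<le> 2 * C"
        using norm_triangle_ineq4[of "fourier_coeff u k" "fourier_coeff v k"] u[of k] v[of k] by linarith
      then have "(norm (fourier_coeff u k - fourier_coeff v k))\<^sup>2 \<le> (2 * C)\<^sup>2"
        by (rule power_mono) simp
      then show ?thesis by (intro mult_left_mono sobolev_weight_nonneg) (simp add: power_mult_distrib)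
    qed
    have wC: "(\<lambda>k. ?w k * (4 * C\<^sup>2)) summable_on A" for A
      by (intro summable_on_cmult_left w)
    have t: "?t summable_on A" for A
      by (rule summable_on_comparison_test[OF wC le]) (simp add: sobolev_weight_nonneg)
    have "infsum ?t (K \<union> - K) = infsum ?t K + infsum ?t (- K)"
      by (intro infsum_Un_disjoint t) auto
    moreover have "infsum ?t K \<le> e\<^sup>2 / 4"
    proof -
      have "infsum ?t K = sum ?t K" using K(1) by simp
      also have "\<dots> \<le> (\<Sum>k\<in>K. ?w k * \<delta>\<^sup>2)"
        using uv by (intro sum_mono mult_left_mono power_mono sobolev_weight_nonneg) (auto intro: less_imp_le)
      also have "\<dots> = sum ?w K * \<delta>\<^sup>2" by (simp add: sum_distrib_right)
      finally show ?thesis using \<delta>K by simp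
    qed
    moreover have "infsum ?t (- K) \<le> e\<^sup>2 / 4"
    proof -
      have "infsum ?t (- K) \<le> infsum (\<lambda>k. ?w k * (4 * C\<^sup>2)) (- K)"
        by (intro infsum_mono t wC le)
      also have "\<dots> = infsum ?w (- K) * (4 * C\<^sup>2)"
        by (intro infsum_cmult_left w)
      also have "\<dots> \<le> \<epsilon> * (4 * C\<^sup>2)"
        using tail by (intro mult_right_mono) auto
      finally show ?thesis using \<epsilon>C by (simp add: mult_ac)
    qed
    moreover have "e\<^sup>2 > 0" using e by simp
    ultimately have "infsum ?t (K \<union> - K) < e\<^sup>2" by linarith
    then have "infsum ?t UNIV < e\<^sup>2" by simp
    then have "sqrt (infsum ?t UNIV) < sqrt (e\<^sup>2)" by (rule real_sqrt_less_mono)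
    then show ?thesis using e by (simp add: sobolev_dist_def)
  qed
  then show thesis using that K(1) \<delta> by blast
qed

theorem bounded_sequence_sobolev_subsequence:
  fixes F :: "nat \<Rightarrow> real^'d \<Rightarrow> complex^'n^'n"
  assumes cont: "\<And>m. continuous_on (cbox 0 1) (F m)" and bnd: "\<And>m x. norm (F m x) \<le> C"
  obtains r H where "\<And>m. r m \<ge> m"
    "sobolev_converges_matrix (- real CARD('d)) (\<lambda>m. F (r m)) H"
proof -
  let ?s = "- real CARD('d)"
  let ?D = "\<lambda>m i j. distribution_of (\<lambda>x. F m x $ i $ j)"
  let ?cont = "\<lambda>\<phi> :: real^'d \<Rightarrow> complex. continuous_on (cbox 0 1) \<phi>"
  let ?I = "\<lambda>\<phi>. integral (cbox 0 1) (\<lambda>x::real^'d. norm (\<phi> x :: complex))"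
  have C: "C \<ge> 0" using order_trans[OF norm_ge_zero bnd] .
  have Fc: "?cont (\<lambda>x. F m x $ i $ j)" for m i j
    by (intro continuous_intros cont)
  have Fb: "norm (F m x $ i $ j) \<le> C" for m x i j
    using order_trans[OF Finite_Cartesian_Product.norm_nth_le
        order_trans[OF Finite_Cartesian_Product.norm_nth_le bnd]] .
  have Db: "norm (?D m i j \<phi>) \<le> C * ?I \<phi>" if "?cont \<phi>" for m i j \<phi>
    by (intro distribution_of_bound Fc Fb that)
  have Dlin: "?D m i j (\<lambda>x. c * \<phi> x + \<psi> x) = c * ?D m i j \<phi> + ?D m i j \<psi>"
    if "?cont \<phi>" "?cont \<psi>" for m i j \<phi> \<psi> c
    by (intro distribution_of_linear Fc that)
  \<comment> \<open>The value 0 at functions that are not continuous makes the bound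
    \<open>b\<close> hold on every coordinate, as the product of discs requires.\<close>
  define v where "v m = (\<lambda>(i, j, \<phi>). if ?cont \<phi> then ?D m i j \<phi> else 0)" for m
  define b where "b = (\<lambda>(i :: 'n, j :: 'n, \<phi>). C * ?I \<phi>)"
  have I: "?I \<phi> \<ge> 0" for \<phi> :: "real^'d \<Rightarrow> complex"
    by (cases "(\<lambda>x. norm (\<phi> x)) integrable_on cbox 0 1")
      (simp_all add: integral_nonneg not_integrable_integral)
  have "norm (v m p) \<le> b p" for m p
  proof -
    obtain i j \<phi> where p: "p = (i, j, \<phi>)" by (cases p)
    show ?thesis
      unfolding p v_def b_def prod.case using C I[of \<phi>] Db[of \<phi> m i j] by simp
  qed
  then obtain u where ub: "\<And>p. norm (u p) \<le> b p"
    and cl: "\<And>P e M. finite P \<Longrightarrow> e > 0 \<Longrightarrow> \<exists>m\<ge>M. \<forall>p\<in>P. norm (v m p - u p) < e"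
    using bounded_functions_cluster[of v b] by metis
  define H :: "('d torus_functional)^'n^'n" where "H = (\<chi> i j. (\<lambda>\<phi>. u (i, j, \<phi>)))"
  have Hb: "norm ((H $ i $ j) \<phi>) \<le> C * ?I \<phi>" for i j \<phi>
    using ub[of "(i, j, \<phi>)"] by (simp add: H_def b_def)
  have Hlin: "(H $ i $ j) (\<lambda>x. c * \<phi> x + \<psi> x) = c * (H $ i $ j) \<phi> + (H $ i $ j) \<psi>"
    if \<phi>: "?cont \<phi>" and \<psi>: "?cont \<psi>" for i j \<phi> \<psi> c
  proof -
    let ?h = "H $ i $ j" and ?\<theta> = "\<lambda>x. c * \<phi> x + \<psi> x"
    have \<theta>: "?cont ?\<theta>" by (intro continuous_intros \<phi> \<psi>)
    have "norm (?h ?\<theta> - (c * ?h \<phi> + ?h \<psi>)) \<le> e" if e: "e > 0" for e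
    proof -
      \<comment> \<open>One \<open>m\<close> approximates the three values at \<open>\<phi>\<close>,
        \<open>\<psi>\<close> and their combination; the errors come with factors
        \<open>norm c\<close>, 1 and 1.\<close>
      define \<eta> where "\<eta> = e / (norm c + 2)"
      have cp: "norm c + 2 > 0" by (simp add: add_nonneg_pos)
      have \<eta>: "\<eta> > 0" using e cp by (simp add: \<eta>_def)
      obtain m where m: "\<forall>p\<in>{(i, j, \<phi>), (i, j, \<psi>), (i, j, ?\<theta>)}. norm (v m p - u p) < \<eta>"
        using cl[of "{(i, j, \<phi>), (i, j, \<psi>), (i, j, ?\<theta>)}" \<eta>] \<eta> by auto
      have 1: "norm (?D m i j \<phi> - ?h \<phi>) < \<eta>" and 2: "norm (?D m i j \<psi> - ?h \<psi>) < \<eta>"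
        and 3: "norm (?D m i j ?\<theta> - ?h ?\<theta>) < \<eta>"
        using m \<phi> \<psi> \<theta> by (simp_all add: v_def H_def)
      have "?h ?\<theta> - (c * ?h \<phi> + ?h \<psi>)
          = c * (?D m i j \<phi> - ?h \<phi>) + (?D m i j \<psi> - ?h \<psi>) - (?D m i j ?\<theta> - ?h ?\<theta>)"
        using Dlin[OF \<phi> \<psi>] by (simp add: algebra_simps)
      also have "norm \<dots> \<le> norm c * \<eta> + \<eta> + \<eta>"
      proof -
        have "norm (x + y - z) \<le> norm x + norm y + norm z" for x y z :: complex
          using norm_triangle_ineq4[of "x + y" z] norm_triangle_ineq[of x y] by linarith
        note tri = order_trans[OF this]
        show ?thesis
          by (intro tri add_mono)
            (use 1 2 3 in \<open>simp_all add: norm_mult mult_left_mono less_imp_le\<close>)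
      qed
      also have "\<dots> = (norm c + 2) * \<eta>" by (simp add: algebra_simps)
      also have "\<dots> = e" using cp by (simp add: \<eta>_def)
      finally show ?thesis .
    qed
    then have "norm (?h ?\<theta> - (c * ?h \<phi> + ?h \<psi>)) \<le> 0"
      by (rule field_le_epsilon) simp
    then show ?thesis by simp
  qed
  have "\<exists>m\<ge>n. \<forall>i j. sobolev_dist ?s (?D m i j) (H $ i $ j) < inverse (real (Suc n))" for n
  proof -
    obtain K :: "(int^'d) set" and \<delta> where K: "finite K" "\<delta> > 0"
      and Kd: "\<And>u v :: 'd torus_functional. \<lbrakk>\<And>k. norm (fourier_coeff u k) \<le> C;
        \<And>k. norm (fourier_coeff v k) \<le> C;
        \<And>k. k \<in> K \<Longrightarrow> norm (fourier_coeff u k - fourier_coeff v k) < \<delta>\<rbrakk>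
        \<Longrightarrow> sobolev_dist ?s u v < inverse (real (Suc n))"
    proof -
      have "inverse (real (Suc n)) > 0" by simp
      from sobolev_dist_small[where 'd = 'd, OF this C] show thesis using that by blast
    qed
    let ?e = "\<lambda>k (x :: real^'d). cis (- 2 * pi * (x \<bullet> lattice_vec k))"
    \<comment> \<open>All matrix entries are treated together, so that a single \<open>m\<close>
      serves every \<open>i\<close> and \<open>j\<close>.\<close>
    let ?P = "(\<lambda>(i, j, k). (i, j, ?e k)) ` (UNIV \<times> UNIV \<times> K)"
    obtain m where m: "m \<ge> n" "\<forall>p\<in>?P. norm (v m p - u p) < \<delta>"
      using cl[of ?P \<delta> n] K by auto
    have "sobolev_dist ?s (?D m i j) (H $ i $ j) < inverse (real (Suc n))" for i j
    proof (rule Kd)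
      show "norm (fourier_coeff (?D m i j) k - fourier_coeff (H $ i $ j) k) < \<delta>" if "k \<in> K" for k
      proof -
        have "(i, j, ?e k) \<in> ?P" using that by force
        then have "norm (v m (i, j, ?e k) - u (i, j, ?e k)) < \<delta>" using m(2) by blast
        then show ?thesis
          using continuous_fourier_mode[of "cbox 0 1" k] by (simp add: v_def H_def fourier_coeff_def)
      qed
    qed (intro fourier_coeff_bound Db Hb; assumption)+
    then show ?thesis using m(1) by blast
  qed
  \<comment> \<open>The indices need not increase strictly; tending to infinity is enough for the
    smooth convergence to survive.\<close>
  then obtain r where r: "\<And>n. r n \<ge> n"
    and rd: "\<And>n i j. sobolev_dist ?s (?D (r n) i j) (H $ i $ j) < inverse (real (Suc n))"
    by metis
  have "sobolev_converges ?s (\<lambda>m. ?D (r m) i j) (H $ i $ j)" for i j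
    unfolding sobolev_converges_def
  proof (intro conjI allI)
    show "?D (r m) i j \<in> sobolev ?s" for m
      by (rule bounded_functional_sobolev[OF Dlin Db C])
    show "H $ i $ j \<in> sobolev ?s"
      by (rule bounded_functional_sobolev[OF Hlin Hb C])
    show "(\<lambda>m. sobolev_dist ?s (?D (r m) i j) (H $ i $ j)) \<longlonglongrightarrow> 0"
    proof (rule Lim_null_comparison[OF _ LIMSEQ_inverse_real_of_nat])
      have "sobolev_dist ?s (?D (r m) i j) (H $ i $ j) \<ge> 0" for m
        by (simp add: sobolev_dist_def infsum_nonneg sobolev_weight_nonneg)
      then show "\<forall>\<^sub>F m in sequentially. norm (sobolev_dist ?s (?D (r m) i j) (H $ i $ j)) \<le> inverse (real (Suc m))"
        using rd by (simp add: less_imp_le del: of_nat_Suc)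
    qed
  qed
  then have "sobolev_converges_matrix ?s (\<lambda>m. F (r m)) H"
    by (simp add: sobolev_converges_matrix_def)
  with r show thesis by (rule that)
qed

section \<open>Smooth maps under constant translations\<close>

lemma partial_derivs_bounded_linear:
  assumes L: "bounded_linear L" and f: "\<And>is x. partial_derivs is f differentiable (at x)"
  shows "partial_derivs is (\<lambda>x. L (f x)) = (\<lambda>x. L (partial_derivs is f x))"
proof (induction "is")
  case (Cons i "is")
  show ?case
  proof
    fix x
    have "(partial_derivs is f has_derivative frechet_derivative (partial_derivs is f) (at x)) (at x)"
      using f frechet_derivative_works by blast
    from bounded_linear.has_derivative[OF L this]
    have "frechet_derivative (\<lambda>x. L (partial_derivs is f x)) (at x)
        = (\<lambda>h. L (frechet_derivative (partial_derivs is f) (at x) h))"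
      by (rule frechet_derivative_at[symmetric])
    then show "partial_derivs (i # is) (\<lambda>x. L (f x)) x = L (partial_derivs (i # is) f x)"
      by (simp add: Cons)
  qed
qed simp

lemma torus_smooth_bounded_linear:
  assumes L: "bounded_linear L" and f: "f \<in> torus_smooth"
  shows "(\<lambda>x. L (f x)) \<in> torus_smooth"
proof -
  have d: "partial_derivs is f differentiable (at x)" for "is" x
    using f unfolding torus_smooth_def by blast
  have "(\<lambda>x. L (partial_derivs is f x)) differentiable (at x)" for "is" x
    using bounded_linear.has_derivative[OF L] d[of "is" x] unfolding differentiable_def by blast
  then show ?thesis
    using f unfolding torus_smooth_def by (simp add: partial_derivs_bounded_linear[OF L d])
qed

lemma partial_derivs_const: "partial_derivs is (\<lambda>_. c) = (\<lambda>_. if is = [] then c else 0)"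
  by (induction "is") auto

lemma bounded_linear_two_sided_mult: "bounded_linear (\<lambda>X :: complex^'n^'n. D ** X ** E)"
  by (rule bounded_linear_compose[OF matrix_mult.bounded_linear_left matrix_mult.bounded_linear_right])

lemma (in compact_unitary_group) torus_smooth_into_mult_left:
  assumes "g \<in> G" "f \<in> torus_smooth_into G"
  shows "(\<lambda>x. g ** f x) \<in> torus_smooth_into G"
  using assms torus_smooth_bounded_linear[OF matrix_mult.bounded_linear_right, of f g]
  by (simp add: torus_smooth_into_def mult_in)

text \<open>The factors do not depend on \<open>x\<close>, so partial derivatives pass through them.
  By unitarity the error splits into that of \<open>f m\<close> and that of \<open>D m\<close>
  against a fixed matrix, the latter being uniform in \<open>x\<close>.\<close>

lemma (in compact_unitary_group) smooth_converges_translate_const: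
  fixes f :: "nat \<Rightarrow> real^'d \<Rightarrow> complex^'n^'n"
  assumes D: "D \<longlonglongrightarrow> D'" "\<And>m. D m \<in> G" and E: "E \<in> G"
    and f: "smooth_converges f (\<lambda>_. K)"
  shows "smooth_converges (\<lambda>m x. D m ** f m x ** E) (\<lambda>_. D' ** K ** E)"
proof -
  have fs: "f m \<in> torus_smooth" and Ks: "(\<lambda>_ :: real^'d. K) \<in> torus_smooth"
    and ul: "uniform_limit UNIV (\<lambda>m. partial_derivs is (f m)) (partial_derivs is (\<lambda>_. K)) sequentially"
    for m "is"
    using f by (simp_all add: smooth_converges_def)
  have fd: "partial_derivs is (f m) differentiable (at x)" for m "is" x
    using fs unfolding torus_smooth_def by blast
  have "uniform_limit UNIV (\<lambda>m. partial_derivs is (\<lambda>x. D m ** f m x ** E))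
      (partial_derivs is (\<lambda>_. D' ** K ** E)) sequentially" for "is"
  proof (rule uniform_limitI)
    fix e :: real assume e: "e > 0"
    \<comment> \<open>The partial derivative of the constant limit: the constant for the empty list,
      zero otherwise.\<close>
    define K' where "K' = (if is = [] then K else 0)"
    have K': "partial_derivs is (\<lambda>_. D' ** K ** E) = (\<lambda>_. D' ** K' ** E)"
      by (simp add: partial_derivs_const K'_def fun_eq_iff)
    have "(\<lambda>m. D m ** K') \<longlonglongrightarrow> D' ** K'"
      by (intro matrix_mult.tendsto D tendsto_const)
    then have "\<forall>\<^sub>F m in sequentially. dist (D m ** K') (D' ** K') < e / 2"
      using e by (intro tendstoD) auto
    moreover have "\<forall>\<^sub>F m in sequentially. \<forall>x\<in>UNIV. dist (partial_derivs is (f m) x) K' < e / 2"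
      using uniform_limitD[OF ul, of "e / 2" "is"] e by (simp add: partial_derivs_const K'_def)
    ultimately show "\<forall>\<^sub>F m in sequentially. \<forall>x\<in>UNIV.
        dist (partial_derivs is (\<lambda>x. D m ** f m x ** E) x) (partial_derivs is (\<lambda>_. D' ** K ** E) x) < e"
    proof eventually_elim
      case (elim m)
      show ?case
      proof
        fix x
        let ?p = "partial_derivs is (f m) x"
        have "dist (D m ** ?p ** E) (D' ** K' ** E) = norm ((D m ** ?p - D' ** K') ** E)"
          by (simp add: dist_norm matrix_mult.diff_left)
        also have "\<dots> = norm (D m ** (?p - K') + (D m ** K' - D' ** K'))"
          by (simp add: norm_unitary_right unitary E matrix_mult.diff_right)
        also have "\<dots> \<le> norm (D m ** (?p - K')) + norm (D m ** K' - D' ** K')"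
          by (rule norm_triangle_ineq)
        also have "\<dots> = norm (?p - K') + norm (D m ** K' - D' ** K')"
          by (simp add: norm_unitary_left unitary D)
        also have "\<dots> < e"
          using elim(1) elim(2)[rule_format, of x] by (simp add: dist_norm)
        finally show "dist (partial_derivs is (\<lambda>x. D m ** f m x ** E) x)
            (partial_derivs is (\<lambda>_. D' ** K ** E) x) < e"
          by (simp add: K' partial_derivs_bounded_linear[OF bounded_linear_two_sided_mult fd])
      qed
    qed
  qed
  then show ?thesis
    unfolding smooth_converges_def
    using torus_smooth_bounded_linear[OF bounded_linear_two_sided_mult] fs Ks by blast
qed

lemma smooth_converges_compose:
  assumes "smooth_converges F f" "filterlim r sequentially sequentially"
  shows "smooth_converges (\<lambda>m. F (r m)) f"
  using assms filterlim_compose[OF _ assms(2)] unfolding smooth_converges_def by blast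

lemma (in compact_unitary_group) conj_cocycle_translate:
  assumes "g \<in> G" "\<And>x. H x \<in> G"
  shows "conj_cocycle \<alpha> (\<lambda>x. g ** H x) A = (\<lambda>x. g ** conj_cocycle \<alpha> H A x ** adjoint_matrix g)"
  using assms
  by (simp add: conj_cocycle_def matrix_inv_unitary unitary mult_in adjoint_mult matrix_mul_assoc)

lemma rotation_vector_exists:
  fixes G T :: "(complex^'n^'n) set" and A :: "real^'d \<Rightarrow> complex^'n^'n"
  assumes G: "compact_lie_group G" and conn: "connected G" and T: "maximal_torus G T"
    and ar: "almost_reducible G \<alpha> A"
  obtains H a where "H \<in> sobolev_into (- real CARD('d)) G" "a \<in> lie_algebra T" "matrix_exp a \<in> T"
    "sobolev_reducible (- real CARD('d)) G \<alpha> A H (matrix_exp a)"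
proof -
  interpret compact_unitary_group G by unfold_locales (rule G)
  have tor: "torus_group T" and TG: "T \<subseteq> G"
    using T by (auto simp: maximal_torus_def)
  interpret T: compact_unitary_group T
    using tor by unfold_locales (simp add: torus_group_def)
  obtain Q :: "nat \<Rightarrow> real^'d \<Rightarrow> complex^'n^'n" and C where Q: "\<And>m. Q m \<in> torus_smooth_into G"
    and C: "\<And>m. C m \<in> G"
    and lim: "smooth_converges (\<lambda>m x. matrix_inv (C m) ** conj_cocycle \<alpha> (Q m) A x) (\<lambda>_. mat 1)"
    using ar unfolding almost_reducible_def by blast
  have QG: "Q m x \<in> G" for m x using Q by (simp add: torus_smooth_into_def)
  obtain C' \<rho> where C': "C' \<in> G" and \<rho>: "strict_mono \<rho>" and C\<rho>: "(C \<circ> \<rho>) \<longlonglongrightarrow> C'"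
    using compact_G C unfolding compact_def by metis
  obtain g where g: "g \<in> G" and gT: "g ** C' ** adjoint_matrix g \<in> T"
    using conj_in_maximal_torus[OF conn T C'] .
  have "connected T" "\<And>h k. h \<in> T \<Longrightarrow> k \<in> T \<Longrightarrow> h ** k = k ** h"
    using tor by (auto simp: torus_group_def)
  then obtain a where a: "a \<in> lie_algebra T" and ea: "matrix_exp a = g ** C' ** adjoint_matrix g"
    using T.exp_surj_abelian[OF _ _ gT] by blast
  \<comment> \<open>The constant \<open>g\<close> is absorbed into the conjugation, which replaces
    the limit constant \<open>C'\<close> by its conjugate in \<open>T\<close>.\<close>
  define F where "F m = (\<lambda>x. g ** Q (\<rho> m) x)" for m
  have F: "F m \<in> torus_smooth_into G" for m
    unfolding F_def by (rule torus_smooth_into_mult_left[OF g Q])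
  have "smooth_converges (\<lambda>m x. matrix_inv (C (\<rho> m)) ** conj_cocycle \<alpha> (Q (\<rho> m)) A x) (\<lambda>_. mat 1)"
    by (rule smooth_converges_compose[OF lim filterlim_subseq[OF \<rho>]])
  moreover have "(\<lambda>m. g ** C (\<rho> m)) \<longlonglongrightarrow> g ** C'"
    using C\<rho> by (intro matrix_mult.tendsto tendsto_const) (simp add: o_def)
  ultimately have "smooth_converges
      (\<lambda>m x. (g ** C (\<rho> m)) ** (matrix_inv (C (\<rho> m)) ** conj_cocycle \<alpha> (Q (\<rho> m)) A x) ** adjoint_matrix g)
      (\<lambda>_. (g ** C') ** mat 1 ** adjoint_matrix g)"
    by (intro smooth_converges_translate_const mult_in adjoint_in g C)
  moreover have "(g ** C (\<rho> m)) ** (matrix_inv (C (\<rho> m)) ** conj_cocycle \<alpha> (Q (\<rho> m)) A x) ** adjoint_matrix g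
      = conj_cocycle \<alpha> (F m) A x" for m x
  proof -
    have "(g ** C (\<rho> m)) ** (matrix_inv (C (\<rho> m)) ** conj_cocycle \<alpha> (Q (\<rho> m)) A x)
        = g ** (C (\<rho> m) ** matrix_inv (C (\<rho> m))) ** conj_cocycle \<alpha> (Q (\<rho> m)) A x"
      by (simp only: matrix_mul_assoc)
    then show ?thesis
      unfolding F_def conj_cocycle_translate[OF g QG]
      by (simp add: matrix_inv_unitary[OF unitary[OF C]] mult_adjoint_self[OF C])
  qed
  ultimately have conv: "smooth_converges (\<lambda>m. conj_cocycle \<alpha> (F m) A) (\<lambda>_. matrix_exp a)"
    by (simp add: ea)
  \<comment> \<open>Unitary matrices all have the norm of the identity, which gives a bound uniform
    in \<open>m\<close> and \<open>x\<close>.\<close>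
  have "norm (F m x) \<le> norm (mat 1 :: complex^'n^'n)" for m x
    using F[of m] norm_unitary[OF unitary, of "F m x"] by (simp add: torus_smooth_into_def)
  moreover have "continuous_on (cbox 0 1) (F m)" for m
    using F[of m] by (intro torus_smooth_continuous) (simp add: torus_smooth_into_def)
  ultimately obtain r H where r: "\<And>m. r m \<ge> m"
    and H: "sobolev_converges_matrix (- real CARD('d)) (\<lambda>m. F (r m)) H"
    using bounded_sequence_sobolev_subsequence[of F] by metis
  have "filterlim r sequentially sequentially"
    using r by (intro filterlim_at_top_mono[OF filterlim_ident] always_eventually) simp
  from smooth_converges_compose[OF conv this]
  have conv': "smooth_converges (\<lambda>m. conj_cocycle \<alpha> (F (r m)) A) (\<lambda>_. matrix_exp a)" .
  have HG: "H \<in> sobolev_into (- real CARD('d)) G"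
    unfolding sobolev_into_def using F H by (intro CollectI exI[of _ "\<lambda>m. F (r m)"]) simp
  moreover have eT: "matrix_exp a \<in> T" using gT ea by simp
  moreover have "sobolev_reducible (- real CARD('d)) G \<alpha> A H (matrix_exp a)"
    unfolding sobolev_reducible_def using HG eT TG F H conv'
    by (intro conjI exI[of _ "\<lambda>m. F (r m)"]) auto
  ultimately show thesis using that a by blast
qed

theorem theorem3p2:
  fixes G T :: "(complex^'n^'n) set"
    and \<alpha> :: "real^'d"
    and A :: "real^'d \<Rightarrow> complex^'n^'n"
  assumes "compact_lie_group G" and "connected G"
    and "maximal_torus G T"
    and "diophantine \<alpha>"
    and "A \<in> torus_smooth_into G"
    and "almost_reducible G \<alpha> A"
  shows "\<exists>(s::real). \<exists>H \<in> sobolev_into s G. \<exists>a \<in> lie_algebra T.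
           matrix_exp a \<in> T \<and> sobolev_reducible s G \<alpha> A H (matrix_exp a) \<and>
           rotation_vector G T \<alpha> A a"
proof -
  obtain H a where "H \<in> sobolev_into (- real CARD('d)) G" "a \<in> lie_algebra T" "matrix_exp a \<in> T"
    "sobolev_reducible (- real CARD('d)) G \<alpha> A H (matrix_exp a)"
    using rotation_vector_exists[OF assms(1-3,6)] by blast
  then show ?thesis
    unfolding rotation_vector_def by blast
qed

end
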